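(* Let $\{\mathbf X_t\}$ be a BRCMNBINAR(1) process with true parameter vector $\boldsymbol\tau$, let $\hat{\boldsymbol\tau}^{CML}$ be the conditional maximum likelihood estimator based on $\mathbf X_1,\dots,\mathbf X_n$, and let $p_h(\mathbf X_{n+h}\mid\mathbf X_n,\boldsymbol\tau)$ be the $h$-step-ahead forecasting conditional distribution under the parameter $\boldsymbol\tau$. For fixed $\mathbf X_1\in\mathbb N_0^2$, the quantity $p_h(\mathbf X_{n+h}\mid\mathbf X_n,\hat{\boldsymbol\tau}^{CML})$ has an asymptotically normal distribution, that is, $$\sqrt{n-1}\,\big(p_h(\mathbf X_{n+h}\mid\mathbf X_n,\hat{\boldsymbol\tau}^{CML})-p_h(\mathbf X_{n+h}\mid\mathbf X_n,\boldsymbol\tau)\big)\xrightarrow{L}N(0,\sigma^2),$$ where $\sigma^2=\mathbf D\,\mathbf I^{-1}\mathbf D^T$, $\mathbf D=\partial p_h(\mathbf X_{n+h}\mid\mathbf X_n,\boldsymbol\tau)/\partial\boldsymbol\tau^T$ is a vector of partial derivatives, and $\mathbf I$ is the Fisher information matrix. Furthermore, the $100(1-\alpha)\%$ confidence interval for $p_h(\mathbf X_{n+h}\mid\mathbf X_n,\hat{\boldsymbol\tau}^{CML})$ is given by $$\Big(p_h(\mathbf X_{n+h}\mid\mathbf X_n,\hat{\boldsymbol\tau}^{CML})-\tfrac{\sigma}{\sqrt{n-1}}u_{1-\frac{\alpha}{2}},\ \ p_h(\mathbf X_{n+h}\mid\mathbf X_n,\hat{\boldsymbol\tau}^{CML})+\tfrac{\sigma}{\sqrt{n-1}}u_{1-\frac{\alpha}{2}}\Big),$$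 where $u_{1-\frac{\alpha}{2}}$ is the $(1-\frac{\alpha}{2})$ upper quantile of the standard normal distribution.
   Context: $\mathbb N_0=\{0,1,2,\dots\}$; $\xrightarrow{L}$ denotes convergence in distribution. Modified negative binomial operator: for $a>0$ and an $\mathbb N_0$-valued random variable $X$, $a\diamond X=\sum_{j=1}^{X+1}G_j$, where $\{G_j\}$ are i.i.d. geometric with parameter $\frac{a}{1+a}$, i.e. $P(G_j=k)=\frac{a^k}{(1+a)^{k+1}}$, $k\in\mathbb N_0$ (mean $a$), independent of $X$. When $a$ is random, this is understood conditionally on $a$. BRCMNBINAR(1) process: an $\mathbb N_0^2$-valued process $\mathbf X_t=(X_{1,t},X_{2,t})^T$ with $X_{i,t}=\alpha_{i,t}\diamond X_{i,t-1}+Z_{i,t}$, $i=1,2$, where: (i) for $i=1,2$, $\{\alpha_{i,t}\}_t$ is i.i.d. Beta prime with density $f(x)=x^{m_i-1}(1+x)^{-m_i-l-1}/B(m_i,l+1)$, $x>0$ ($B$ is the Beta function), where $l>1$ is a known constant and $0<m_i<l$; $\{\alpha_{1,t}\}$ and $\{\alpha_{2,t}\}$ are mutually independent; (ii) $\mathbf Z_t=(Z_{1,t},Z_{2,t})^T$ are i.i.d. $\mathbb N_0^2$-valued random vectors with joint pmf $f_{\mathbf Z}$ (from a parametric family), $E(Z_{i,t})=\mu_i$, finite variances, $\mathrm{Cov}(Z_{1,t},Z_{2,t})=\phi$; $\mathbf Z_t$ is independent of $(\alpha_{1,t}\diamond X_{1,t-1},\alpha_{2,t}\diamond X_{2,t-1})$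 and of $\mathbf X_s$ for $s<t$; (iii) given the coefficients, the counting variables $G_j$ used in different components and at different times are independent; the triples (coefficients, counting variables, $\mathbf Z_t$) are independent over $t$ and independent of $\mathbf X_s$, $s<t$; (iv) $(m_1,\mu_1)\neq(m_2,\mu_2)$. This is a time-homogeneous Markov chain on $\mathbb N_0^2$. The vector $\boldsymbol\tau$ collects the unknown parameters of its one-step transition probabilities ($m_1,m_2$ and the parameters of $f_{\mathbf Z}$). The estimator $\hat{\boldsymbol\tau}^{CML}$ maximizes $\log\prod_{t=2}^nP_{\boldsymbol\tau}(\mathbf X_t=\mathbf x_t\mid\mathbf X_{t-1}=\mathbf x_{t-1})$ over the parameter space, where $\mathbf x_1,\dots,\mathbf x_n$ are the observed values. For $h\in\mathbb N$, $p_h(\mathbf X_{n+h}\mid\mathbf X_n,\boldsymbol\tau)$ is shorthand for the $h$-step-ahead conditional probability $P_{\boldsymbol\tau}(\mathbf X_{n+h}=\mathbf x_{n+h}\mid\mathbf X_n=\mathbf x_n)$, and $p_h(\mathbf X_{n+h}\mid\mathbf X_n,\hat{\boldsymbol\tau}^{CML})$ is the same quantity with $\hat{\boldsymbol\tau}^{CML}$ in place of $\boldsymbol\tau$. Standing assumption: standard regularity conditions hold, under which $\sqrt{n-1}(\hat{\boldsymbol\tau}^{CML}-\boldsymbol\tau)\xrightarrow{L}N(\mathbf 0,\mathbf I^{-1})$, with $\mathbf I$ the Fisher information matrix.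
   Formalization: The confidence interval is shown to have asymptotic coverage 1−α of the true forecast probability only when σ > 0; if σ = 0 (e.g. an unreachable forecast state, where D = 0) the stated open interval is empty and cannot have that coverage. *)

theory Defs
  imports "HOL-Probability.Probability"
begin

text \<open>
  States are elements of \<^typ>\<open>nat ^ 2\<close>, and the two components are indexed by the type
  \<^typ>\<open>2\<close>.
  Parameter vectors have index type \<^typ>\<open>2 + 'd\<close>: the entries \<open>Inl i\<close> are the two
  Beta prime parameters, the entries \<open>Inr j\<close> are the parameters of the innovation family.
\<close>

type_synonym state = "nat ^ 2"

definition coef :: "real ^ (2 + 'd::finite) \<Rightarrow> 2 \<Rightarrow> real" where
  "coef \<tau> i = \<tau> $ Inl i"

definition innov :: "real ^ (2 + 'd::finite) \<Rightarrow> real ^ 'd" where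
  "innov \<tau> = (\<chi> j. \<tau> $ Inr j)"


subsection \<open>The modified negative binomial operator\<close>

text \<open>
  \<^const>\<open>geometric_pmf\<close> takes the success probability, so parameter \<open>1 / (1 + a)\<close> gives
  the mass function \<open>a ^ k / (1 + a) ^ (k + 1)\<close>. The \<open>x + 1\<close> summands are
  indexed by \<open>0, \<dots>, x\<close>.
\<close>

definition counting_pmf :: "real \<Rightarrow> nat pmf" where
  "counting_pmf a = geometric_pmf (1 / (1 + a))"

definition diamond_pmf :: "real \<Rightarrow> nat \<Rightarrow> nat pmf" where
  "diamond_pmf a x = map_pmf (\<lambda>g. \<Sum>j\<le>x. g j) (Pi_pmf {..x} 0 (\<lambda>_. counting_pmf a))"

definition beta_prime :: "real \<Rightarrow> real \<Rightarrow> real measure" where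
  "beta_prime m l = density lborel (\<lambda>x. ennreal (indicator {0<..} x *
     (x powr (m - 1) * (1 + x) powr (- m - l - 1) / Beta m (l + 1))))"

text \<open>Mass function of \<open>\<alpha> \<diamond> x\<close> when \<open>\<alpha>\<close> is Beta prime: the operator is
  understood conditionally on \<open>\<alpha>\<close>, and \<open>\<alpha>\<close> is integrated out.\<close>

definition diamond_prob :: "real \<Rightarrow> real \<Rightarrow> nat \<Rightarrow> nat \<Rightarrow> real" where
  "diamond_prob m l x k = (\<integral>a. pmf (diamond_pmf a x) k \<partial>beta_prime m l)"


subsection \<open>The process\<close>

text \<open>\<^const>\<open>prob_space.indep_var\<close> needs both variables to have the same value type.\<close>

definition indep_rv ::
    "'a measure \<Rightarrow> 'b measure \<Rightarrow> ('a \<Rightarrow> 'b) \<Rightarrow> 'c measure \<Rightarrow> ('a \<Rightarrow> 'c) \<Rightarrow> bool" where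
  "indep_rv M N V N' W \<longleftrightarrow> V \<in> measurable M N \<and> W \<in> measurable M N' \<and>
     prob_space.indep_set M (sets (vimage_algebra (space M) V N))
                            (sets (vimage_algebra (space M) W N'))"

text \<open>
  Time starts at 1, so the driving variables are those with \<open>t \<ge> 2\<close>.
  The assumption \<open>coef_counting\<close> is the joint law of coefficients and counting variables at
  time \<open>t\<close>: the two coefficients are independent and Beta prime (take \<open>r = 0\<close>), and given
  the coefficients all counting variables, in either component, are independent and
  geometric. In \<open>innov_indep\<close>, \<open>Z t\<close> is independent of the thinned
  vector and the past jointly.
\<close>

locale brcmnbinar = prob_space M
  for M :: "'a measure"
    and l :: real and m :: "2 \<Rightarrow> real" and f :: "state pmf"
    and \<alpha> :: "2 \<Rightarrow> nat \<Rightarrow> 'a \<Rightarrow> real"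
    and G :: "2 \<Rightarrow> nat \<Rightarrow> nat \<Rightarrow> 'a \<Rightarrow> nat"
    and Z :: "nat \<Rightarrow> 'a \<Rightarrow> state"
    and X :: "nat \<Rightarrow> 'a \<Rightarrow> state" +
  assumes l_gt: "1 < l"
    and m_range: "\<And>i. 0 < m i \<and> m i < l"
    and second_moments: "\<And>i. integrable (measure_pmf f) (\<lambda>z. (real (z $ i))\<^sup>2)"
    and distinct_params:
      "(m 1, measure_pmf.expectation f (\<lambda>z. real (z $ 1)))
         \<noteq> (m 2, measure_pmf.expectation f (\<lambda>z. real (z $ 2)))"
    and meas_\<alpha>: "\<And>i t. 2 \<le> t \<Longrightarrow> random_variable borel (\<alpha> i t)"
    and meas_G: "\<And>i t j. 2 \<le> t \<Longrightarrow> random_variable (count_space UNIV) (G i t j)"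
    and meas_Z: "\<And>t. 2 \<le> t \<Longrightarrow> random_variable (count_space UNIV) (Z t)"
    and meas_X: "\<And>t. 1 \<le> t \<Longrightarrow> random_variable (count_space UNIV) (X t)"
    and recursion: "\<And>t i \<omega>. 2 \<le> t \<Longrightarrow> \<omega> \<in> space M \<Longrightarrow>
      X t \<omega> $ i = (\<Sum>j\<le>X (t - 1) \<omega> $ i. G i t j \<omega>) + Z t \<omega> $ i"
    and coef_counting: "\<And>t r A k. 2 \<le> t \<Longrightarrow> (\<And>i. A i \<in> sets borel) \<Longrightarrow>
      prob {\<omega> \<in> space M. \<forall>i. \<alpha> i t \<omega> \<in> A i \<and> (\<forall>j<r. G i t j \<omega> = k i j)} =
        (\<Prod>i\<in>UNIV. LINT a:A i|beta_prime (m i) l. (\<Prod>j<r. pmf (counting_pmf a) (k i j)))"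
    and innov_distr: "\<And>t. 2 \<le> t \<Longrightarrow> distr M (count_space UNIV) (Z t) = measure_pmf f"
    and innov_indep: "\<And>t. 2 \<le> t \<Longrightarrow>
      indep_rv M (count_space UNIV) (Z t) (count_space UNIV)
        (\<lambda>\<omega>. ((\<chi> i. \<Sum>j\<le>X (t - 1) \<omega> $ i. G i t j \<omega>) :: state,
              map (\<lambda>s. X s \<omega>) [1..<t]))"
    and triples_indep:
      "indep_vars
        (\<lambda>_. (\<Pi>\<^sub>M i\<in>UNIV. borel) \<Otimes>\<^sub>M ((\<Pi>\<^sub>M ij\<in>UNIV. count_space UNIV) \<Otimes>\<^sub>M count_space UNIV))
        (\<lambda>t \<omega>. (\<lambda>i. \<alpha> i t \<omega>, \<lambda>(i, j). G i t j \<omega>, Z t \<omega>)) {2..}"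
    and triples_indep_past: "\<And>t. 2 \<le> t \<Longrightarrow>
      indep_rv M
        ((\<Pi>\<^sub>M i\<in>UNIV. borel) \<Otimes>\<^sub>M ((\<Pi>\<^sub>M ij\<in>UNIV. count_space UNIV) \<Otimes>\<^sub>M count_space UNIV))
        (\<lambda>\<omega>. (\<lambda>i. \<alpha> i t \<omega>, \<lambda>(i, j). G i t j \<omega>, Z t \<omega>))
        (count_space UNIV) (\<lambda>\<omega>. map (\<lambda>s. X s \<omega>) [1..<t])"


subsection \<open>Transition probabilities\<close>

text \<open>In both functions \<open>l\<close> is the known constant and \<open>F\<close> the parametric family of
  innovation distributions. The one-step transition probability is the probability that
  \<open>\<alpha> \<diamond> x + Z = y\<close> with independent summands.\<close>

definition trans_prob ::
    "real \<Rightarrow> (real ^ 'd \<Rightarrow> state pmf) \<Rightarrow> real ^ (2 + 'd::finite) \<Rightarrow> state \<Rightarrow> state \<Rightarrow> real" where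
  "trans_prob l F \<tau> x y = (\<Sum>z | \<forall>i. z $ i \<le> y $ i.
     pmf (F (innov \<tau>)) z * (\<Prod>i\<in>UNIV. diamond_prob (coef \<tau> i) l (x $ i) (y $ i - z $ i)))"

primrec hstep_prob ::
    "real \<Rightarrow> (real ^ 'd \<Rightarrow> state pmf) \<Rightarrow> nat \<Rightarrow> real ^ (2 + 'd::finite) \<Rightarrow> state \<Rightarrow> state \<Rightarrow> real" where
  "hstep_prob l F 0 \<tau> x y = (if x = y then 1 else 0)"
| "hstep_prob l F (Suc h) \<tau> x y = (\<Sum>\<^sub>\<infinity>w. hstep_prob l F h \<tau> x w * trans_prob l F \<tau> w y)"

definition admissible ::
    "real \<Rightarrow> (real ^ 'd \<Rightarrow> state pmf) \<Rightarrow> real ^ (2 + 'd::finite) \<Rightarrow> bool" where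
  "admissible l F \<tau> \<longleftrightarrow> (\<forall>i. 0 < coef \<tau> i \<and> coef \<tau> i < l \<and>
     integrable (measure_pmf (F (innov \<tau>))) (\<lambda>z. (real (z $ i))\<^sup>2))"


subsection \<open>Conditional maximum likelihood\<close>

text \<open>\<^term>\<open>ln 0 = (0::real)\<close> would make impossible paths look likely, hence the extended
  logarithm.\<close>

definition eln :: "real \<Rightarrow> ereal" where
  "eln p = (if p \<le> 0 then -\<infinity> else ereal (ln p))"

text \<open>The list \<open>xs\<close> holds the observed values, with the value at time \<open>t\<close> in position
  \<open>t - 1\<close>.\<close>

definition cond_loglik ::
    "real \<Rightarrow> (real ^ 'd \<Rightarrow> state pmf) \<Rightarrow> state list \<Rightarrow> real ^ (2 + 'd::finite) \<Rightarrow> ereal" where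
  "cond_loglik l F xs \<tau> = eln (\<Prod>t\<in>{1..<length xs}. trans_prob l F \<tau> (xs ! (t - 1)) (xs ! t))"

definition observed :: "(nat \<Rightarrow> 'a \<Rightarrow> state) \<Rightarrow> nat \<Rightarrow> 'a \<Rightarrow> state list" where
  "observed X n \<omega> = map (\<lambda>t. X t \<omega>) [1..<Suc n]"

definition is_cml ::
    "real \<Rightarrow> (real ^ 'd \<Rightarrow> state pmf) \<Rightarrow> (real ^ (2 + 'd::finite)) set \<Rightarrow> state list \<Rightarrow>
     real ^ (2 + 'd) \<Rightarrow> bool" where
  "is_cml l F \<Theta> xs \<tau> \<longleftrightarrow> is_arg_max (cond_loglik l F xs) (\<lambda>\<tau>'. \<tau>' \<in> \<Theta>) \<tau>"

text \<open>On an open parameter space the likelihood of some observed paths has no maximizer (for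
  instance, a path that stays at the origin), so the estimator is a maximizer whenever there
  is one, and this is required to happen with probability tending to one.\<close>

definition cml_estimator ::
    "'a measure \<Rightarrow> (nat \<Rightarrow> 'a \<Rightarrow> state) \<Rightarrow> real \<Rightarrow> (real ^ 'd \<Rightarrow> state pmf) \<Rightarrow>
     (real ^ (2 + 'd::finite)) set \<Rightarrow> (state list \<Rightarrow> real ^ (2 + 'd)) \<Rightarrow> bool" where
  "cml_estimator M X l F \<Theta> est \<longleftrightarrow>
     (\<forall>xs. est xs \<in> \<Theta> \<and> ((\<exists>\<tau>. is_cml l F \<Theta> xs \<tau>) \<longrightarrow> is_cml l F \<Theta> xs (est xs))) \<and>
     (\<lambda>n. measure M {\<omega> \<in> space M. is_cml l F \<Theta> (observed X n \<omega>) (est (observed X n \<omega>))})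
       \<longlonglongrightarrow> 1"


subsection \<open>Derivatives and Fisher information\<close>

definition partial_deriv :: "'k \<Rightarrow> (real ^ 'k::finite \<Rightarrow> real) \<Rightarrow> real ^ 'k \<Rightarrow> real" where
  "partial_deriv k g \<tau> = deriv (\<lambda>s. g (\<tau> + s *\<^sub>R axis k 1)) 0"

definition grad :: "(real ^ 'k::finite \<Rightarrow> real) \<Rightarrow> real ^ 'k \<Rightarrow> real ^ 'k" where
  "grad g \<tau> = (\<chi> k. partial_deriv k g \<tau>)"

definition stationary ::
    "real \<Rightarrow> (real ^ 'd \<Rightarrow> state pmf) \<Rightarrow> real ^ (2 + 'd::finite) \<Rightarrow> state pmf \<Rightarrow> bool" where
  "stationary l F \<tau> \<pi> \<longleftrightarrow> (\<forall>y. ((\<lambda>x. pmf \<pi> x * trans_prob l F \<tau> x y) has_sum pmf \<pi> y) UNIV)"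

text \<open>Information in one transition \<open>(x, y)\<close> of the stationary chain. Impossible transitions
  carry weight 0, so the value of the score there is irrelevant.\<close>

definition score ::
    "real \<Rightarrow> (real ^ 'd \<Rightarrow> state pmf) \<Rightarrow> real ^ (2 + 'd::finite) \<Rightarrow> state \<Rightarrow> state \<Rightarrow>
     real ^ (2 + 'd)" where
  "score l F \<tau> x y = grad (\<lambda>\<tau>'. ln (trans_prob l F \<tau>' x y)) \<tau>"

definition info_term ::
    "real \<Rightarrow> (real ^ 'd \<Rightarrow> state pmf) \<Rightarrow> real ^ (2 + 'd::finite) \<Rightarrow> state pmf \<Rightarrow>
     2 + 'd \<Rightarrow> 2 + 'd \<Rightarrow> state \<times> state \<Rightarrow> real" where
  "info_term l F \<tau> \<pi> j k = (\<lambda>(x, y).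
     pmf \<pi> x * trans_prob l F \<tau> x y * (score l F \<tau> x y $ j * score l F \<tau> x y $ k))"

definition fisher_info ::
    "real \<Rightarrow> (real ^ 'd \<Rightarrow> state pmf) \<Rightarrow> real ^ (2 + 'd::finite) \<Rightarrow> state pmf \<Rightarrow>
     real ^ (2 + 'd) ^ (2 + 'd)" where
  "fisher_info l F \<tau> \<pi> = (\<chi> j k. \<Sum>\<^sub>\<infinity>xy. info_term l F \<tau> \<pi> j k xy)"


subsection \<open>Normal laws and convergence in distribution\<close>

text \<open>The second argument is the variance; variance 0 gives the point mass.\<close>

definition normal_law :: "real \<Rightarrow> real \<Rightarrow> real measure" where
  "normal_law \<mu> v =
     (if v = 0 then return borel \<mu> else density lborel (normal_density \<mu> (sqrt v)))"

text \<open>Multivariate normality: every linear combination of the coordinates is normal.\<close>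

definition multivariate_normal ::
    "(real ^ 'k::finite) measure \<Rightarrow> real ^ 'k \<Rightarrow> real ^ 'k ^ 'k \<Rightarrow> bool" where
  "multivariate_normal \<nu> \<mu> \<Sigma> \<longleftrightarrow>
     prob_space \<nu> \<and> sets \<nu> = sets borel \<and>
     transpose \<Sigma> = \<Sigma> \<and> (\<forall>a. 0 \<le> a \<bullet> (\<Sigma> *v a)) \<and>
     (\<forall>a. distr \<nu> borel (\<lambda>x. a \<bullet> x) = normal_law (a \<bullet> \<mu>) (a \<bullet> (\<Sigma> *v a)))"

text \<open>The library's \<^const>\<open>weak_conv_m\<close> covers measures on the real line only.\<close>

definition weak_conv_vec :: "(nat \<Rightarrow> (real ^ 'k::finite) measure) \<Rightarrow> (real ^ 'k) measure \<Rightarrow> bool" where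
  "weak_conv_vec \<mu> \<nu> \<longleftrightarrow>
     (\<forall>g :: real ^ 'k \<Rightarrow> real. continuous_on UNIV g \<longrightarrow> bounded (range g) \<longrightarrow>
        (\<lambda>n. \<integral>x. g x \<partial>\<mu> n) \<longlonglongrightarrow> (\<integral>x. g x \<partial>\<nu>))"

definition std_normal_quantile :: "real \<Rightarrow> real" where
  "std_normal_quantile q = Inf {u. q \<le> cdf std_normal_distribution u}"


subsection \<open>Regularity\<close>

text \<open>Near \<open>\<theta>\<close> the innovation mass functions are continuously differentiable in the
  parameter, with gradients dominated by a summable function of the state.\<close>

definition smooth_family :: "(real ^ 'd::finite \<Rightarrow> state pmf) \<Rightarrow> real ^ 'd \<Rightarrow> bool" where
  "smooth_family F \<theta> \<longleftrightarrow>
     (\<exists>U g b. open U \<and> \<theta> \<in> U \<and> (b :: state \<Rightarrow> real) summable_on UNIV \<and>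
       (\<forall>z. continuous_on U (g z) \<and>
         (\<forall>\<theta>'\<in>U. ((\<lambda>\<theta>. pmf (F \<theta>) z) has_derivative (\<lambda>v. g z \<theta>' \<bullet> v)) (at \<theta>') \<and>
                  norm (g z \<theta>') \<le> b z)))"

text \<open>The standard regularity conditions on the model at the true parameter \<open>\<tau>\<close>. The asymptotic
  normality of the estimator that they entail is a separate hypothesis.\<close>

definition regular_model ::
    "real \<Rightarrow> (real ^ 'd \<Rightarrow> state pmf) \<Rightarrow> (real ^ (2 + 'd::finite)) set \<Rightarrow> real ^ (2 + 'd) \<Rightarrow>
     state pmf \<Rightarrow> bool" where
  "regular_model l F \<Theta> \<tau> \<pi> \<longleftrightarrow>
     (\<forall>\<tau>'\<in>\<Theta>. admissible l F \<tau>') \<and> \<tau> \<in> interior \<Theta> \<and>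
     smooth_family F (innov \<tau>) \<and>
     stationary l F \<tau> \<pi> \<and>
     (\<forall>j k. info_term l F \<tau> \<pi> j k summable_on UNIV) \<and>
     invertible (fisher_info l F \<tau> \<pi>)"

end

(*
  The parameter enters a transition only through the joint density of the innovation and the two
  Beta prime coefficients; given these draws and the present state, the next state has a law free of
  the parameter. This density is Frechet differentiable as an L1-valued function of the parameter
  (dominated convergence), and L1-differentiability survives products of densities and Markov
  kernels. Induction on h then makes the h-step probabilities differentiable at the true parameter,
  so the delta method applies; it is proved with characteristic functions. The interval has the
  asserted limiting coverage because its boundary is a null set of the normal limit.
*)
theory Submission
  imports Defs "HOL-Real_Asymp.Real_Asymp"
begin

subsection \<open>Differentiability in L1\<close>

text \<open>An h-step probability is an infinite sum over the intermediate state, and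
  differentiability of every single transition probability says nothing about such a sum. So the
  induction carries the whole row \<open>hstep_prob l F h \<tau>' x\<close> as one element of L1
  over the counting measure, where summing against a kernel is a contraction; entries are recovered
  at the end because point evaluation is bounded in that norm. The mixing over the unbounded
  coefficients is handled the same way: among the ingredients of the operator only the Beta prime
  density depends on the parameter, so its logarithmic score has to be dominated just once,
  uniformly in both states. The derivative is asserted at the single point \<tau>, but integrability
  on a neighbourhood of it. The Bochner integral of a non-integrable function is 0, so the limit of
  the quotient alone would not exclude non-integrable densities near \<tau>.\<close>

definition L1_deriv ::
    "'s measure \<Rightarrow> ('p::euclidean_space \<Rightarrow> 's \<Rightarrow> real) \<Rightarrow> ('s \<Rightarrow> 'p) \<Rightarrow> 'p \<Rightarrow> bool" where
  "L1_deriv M \<phi> g \<tau> \<longleftrightarrow>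
     (\<forall>\<^sub>F \<tau>' in nhds \<tau>. integrable M (\<phi> \<tau>')) \<and> integrable M g \<and>
     ((\<lambda>\<tau>'. (\<integral>s. \<bar>\<phi> \<tau>' s - \<phi> \<tau> s - g s \<bullet> (\<tau>' - \<tau>)\<bar> \<partial>M) / norm (\<tau>' - \<tau>)) \<longlongrightarrow> 0) (at \<tau>)"

lemma L1_deriv_integrable:
  assumes "L1_deriv M \<phi> g \<tau>"
  shows "\<forall>\<^sub>F \<tau>' in nhds \<tau>. integrable M (\<phi> \<tau>')" "\<forall>\<^sub>F \<tau>' in at \<tau>. integrable M (\<phi> \<tau>')"
    and "integrable M (\<phi> \<tau>)" "integrable M g"
  using assms eventually_nhds_x_imp_x
  by (auto simp: L1_deriv_def eventually_at_filter elim: eventually_mono)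

text \<open>The integral formula for the h-step probabilities is available only for parameters near
  \<tau>, so agreement on a neighbourhood has to suffice.\<close>

lemma L1_deriv_cong:
  assumes "L1_deriv M \<phi> g \<tau>" and eq: "\<forall>\<^sub>F \<tau>' in nhds \<tau>. \<forall>s. \<psi> \<tau>' s = \<phi> \<tau>' s"
  shows "L1_deriv M \<psi> g \<tau>"
proof -
  have eq': "\<forall>\<^sub>F \<tau>' in nhds \<tau>. \<psi> \<tau>' = \<phi> \<tau>'"
    using eq by (rule eventually_mono) auto
  have [simp]: "\<psi> \<tau> = \<phi> \<tau>"
    using eventually_nhds_x_imp_x[OF eq'] .
  have at: "\<forall>\<^sub>F \<tau>' in at \<tau>. \<psi> \<tau>' = \<phi> \<tau>'"
    using eq' by (auto simp: eventually_at_filter elim: eventually_mono)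
  have "((\<lambda>\<tau>'. (\<integral>s. \<bar>\<psi> \<tau>' s - \<psi> \<tau> s - g s \<bullet> (\<tau>' - \<tau>)\<bar> \<partial>M) / norm (\<tau>' - \<tau>)) \<longlongrightarrow> 0) (at \<tau>)"
    by (rule Lim_transform_eventually
          [where f = "\<lambda>\<tau>'. (\<integral>s. \<bar>\<phi> \<tau>' s - \<phi> \<tau> s - g s \<bullet> (\<tau>' - \<tau>)\<bar> \<partial>M) / norm (\<tau>' - \<tau>)"])
       (use assms(1) eventually_mono[OF at] in \<open>auto simp: L1_deriv_def\<close>)
  moreover have "\<forall>\<^sub>F \<tau>' in nhds \<tau>. integrable M (\<psi> \<tau>')"
    using L1_deriv_integrable(1)[OF assms(1)] eq' by eventually_elim simp
  ultimately show ?thesis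
    using assms(1) by (simp add: L1_deriv_def)
qed

lemma L1_deriv_const: "integrable M \<phi> \<Longrightarrow> L1_deriv M (\<lambda>_. \<phi>) (\<lambda>_. 0) \<tau>"
  by (simp add: L1_deriv_def)

text \<open>On a ball inside \<open>U\<close> the mean value inequality makes \<phi> Lipschitz in
  the parameter with constant \<open>b s\<close>. The linear term is at most \<open>b s\<close>
  times the increment as well, by Cauchy-Schwarz, so the quotient is dominated by
  \<open>2 * b s\<close> while it tends to 0 for each \<open>s\<close>.\<close>

lemma L1_deriv_dominated:
  fixes \<phi> :: "'p::euclidean_space \<Rightarrow> 's \<Rightarrow> real"
  assumes U: "open U" "\<tau> \<in> U"
    and int: "\<And>\<tau>'. \<tau>' \<in> U \<Longrightarrow> integrable M (\<phi> \<tau>')"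
    and der: "\<And>\<tau>' s. \<tau>' \<in> U \<Longrightarrow> s \<in> space M \<Longrightarrow>
      ((\<lambda>\<tau>. \<phi> \<tau> s) has_derivative (\<lambda>v. g \<tau>' s \<bullet> v)) (at \<tau>')"
    and bound: "\<And>\<tau>' s. \<tau>' \<in> U \<Longrightarrow> s \<in> space M \<Longrightarrow> norm (g \<tau>' s) \<le> b s"
    and b: "integrable M b" and g: "g \<tau> \<in> borel_measurable M"
  shows "L1_deriv M \<phi> (g \<tau>) \<tau>"
proof -
  obtain e where e: "e > 0" "ball \<tau> e \<subseteq> U"
    using U open_contains_ball by blast
  have lip: "\<bar>\<phi> \<tau>' s - \<phi> \<tau> s\<bar> \<le> b s * norm (\<tau>' - \<tau>)"
    if "\<tau>' \<in> ball \<tau> e" "s \<in> space M" for \<tau>' s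
  proof -
    have "norm (\<phi> \<tau>' s - \<phi> \<tau> s) \<le> b s * norm (\<tau>' - \<tau>)"
    proof (rule differentiable_bound[where S = "ball \<tau> e"])
      fix x assume "x \<in> ball \<tau> e"
      hence x: "x \<in> U" using e by blast
      show "((\<lambda>\<tau>. \<phi> \<tau> s) has_derivative (\<lambda>v. g x s \<bullet> v)) (at x within ball \<tau> e)"
        using der[OF x that(2)] has_derivative_at_withinI by blast
      show "onorm (\<lambda>v. g x s \<bullet> v) \<le> b s"
      proof (rule onorm_bound)
        show "0 \<le> b s"
          using bound[OF x that(2)] norm_ge_zero order_trans by blast
        show "norm (g x s \<bullet> v) \<le> b s * norm v" for v
          using Cauchy_Schwarz_ineq2[of "g x s" v] bound[OF x that(2)]
          by (metis mult_right_mono norm_ge_zero order_trans real_norm_def)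
      qed
    qed (use that e in auto)
    thus ?thesis by simp
  qed
  have gi: "integrable M (g \<tau>)"
    by (rule Bochner_Integration.integrable_bound[OF b g])
       (use bound U in \<open>force intro!: AE_I2\<close>)
  have "((\<lambda>\<tau>'. (\<integral>s. \<bar>\<phi> \<tau>' s - \<phi> \<tau> s - g \<tau> s \<bullet> (\<tau>' - \<tau>)\<bar> \<partial>M) / norm (\<tau>' - \<tau>)) \<longlongrightarrow> 0) (at \<tau>)"
    unfolding tendsto_at_iff_sequentially comp_def
  proof (intro allI impI)
    fix X :: "nat \<Rightarrow> 'p" assume X: "\<forall>i. X i \<in> UNIV - {\<tau>}" "X \<longlonglongrightarrow> \<tau>"
    \<comment> \<open>Dominated convergence works along sequences; dropping the first
      \<open>N\<close> terms puts the whole sequence into the ball where the Lipschitz bound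
      holds.\<close>
    obtain N where N: "\<And>n. n \<ge> N \<Longrightarrow> X n \<in> ball \<tau> e"
      using X(2) e(1) by (metis centre_in_ball eventually_sequentially open_ball topological_tendstoD)
    define Y where "Y n = X (n + N)" for n
    have Y: "Y n \<in> ball \<tau> e" "Y n \<noteq> \<tau>" "Y n \<in> U" for n
      using N[of "n + N"] X(1) e by (auto simp: Y_def)
    have Ylim: "Y \<longlonglongrightarrow> \<tau>"
      unfolding Y_def using X(2) by (rule LIMSEQ_ignore_initial_segment)
    have [measurable]: "\<phi> (Y n) \<in> borel_measurable M" "\<phi> \<tau> \<in> borel_measurable M" for n
      using int Y(3) U(2) by (auto dest: borel_measurable_integrable)
    note [measurable] = g
    have "(\<lambda>n. \<integral>s. \<bar>\<phi> (Y n) s - \<phi> \<tau> s - g \<tau> s \<bullet> (Y n - \<tau>)\<bar> / norm (Y n - \<tau>) \<partial>M)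
        \<longlonglongrightarrow> (\<integral>s. 0 \<partial>M)"
    proof (rule integral_dominated_convergence[where w = "\<lambda>s. 2 * b s"])
      show "AE s in M. (\<lambda>n. \<bar>\<phi> (Y n) s - \<phi> \<tau> s - g \<tau> s \<bullet> (Y n - \<tau>)\<bar> / norm (Y n - \<tau>)) \<longlonglongrightarrow> 0"
      proof (rule AE_I2)
        fix s assume s: "s \<in> space M"
        have "((\<lambda>y. \<bar>\<phi> y s - \<phi> \<tau> s - g \<tau> s \<bullet> (y - \<tau>)\<bar> / norm (y - \<tau>)) \<longlongrightarrow> 0) (at \<tau>)"
          using der[OF U(2) s] by (simp add: has_derivative_iff_norm)
        thus "(\<lambda>n. \<bar>\<phi> (Y n) s - \<phi> \<tau> s - g \<tau> s \<bullet> (Y n - \<tau>)\<bar> / norm (Y n - \<tau>)) \<longlonglongrightarrow> 0"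
          using Y(2) Ylim unfolding tendsto_at_iff_sequentially comp_def by blast
      qed
      show "AE s in M. norm (\<bar>\<phi> (Y n) s - \<phi> \<tau> s - g \<tau> s \<bullet> (Y n - \<tau>)\<bar> / norm (Y n - \<tau>)) \<le> 2 * b s" for n
      proof (rule AE_I2)
        fix s assume s: "s \<in> space M"
        have "\<bar>g \<tau> s \<bullet> (Y n - \<tau>)\<bar> \<le> b s * norm (Y n - \<tau>)"
          using Cauchy_Schwarz_ineq2[of "g \<tau> s" "Y n - \<tau>"] bound[OF U(2) s]
          by (meson mult_right_mono norm_ge_zero order_trans)
        with lip[OF Y(1) s, of n]
        have "\<bar>\<phi> (Y n) s - \<phi> \<tau> s - g \<tau> s \<bullet> (Y n - \<tau>)\<bar> \<le> 2 * b s * norm (Y n - \<tau>)"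
          by linarith
        thus "norm (\<bar>\<phi> (Y n) s - \<phi> \<tau> s - g \<tau> s \<bullet> (Y n - \<tau>)\<bar> / norm (Y n - \<tau>)) \<le> 2 * b s"
          using Y(2)[of n] by (simp add: pos_divide_le_eq)
      qed
    qed (use b in auto)
    hence "(\<lambda>n. (\<integral>s. \<bar>\<phi> (X (n + N)) s - \<phi> \<tau> s - g \<tau> s \<bullet> (X (n + N) - \<tau>)\<bar> \<partial>M) / norm (X (n + N) - \<tau>)) \<longlonglongrightarrow> 0"
      by (simp add: Y_def)
    thus "(\<lambda>n. (\<integral>s. \<bar>\<phi> (X n) s - \<phi> \<tau> s - g \<tau> s \<bullet> (X n - \<tau>)\<bar> \<partial>M) / norm (X n - \<tau>)) \<longlonglongrightarrow> 0"
      by (rule LIMSEQ_offset)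
  qed
  thus ?thesis
    using gi int U by (auto simp: L1_deriv_def eventually_nhds)
qed

section \<open>Products of densities in separate variables\<close>

lemma (in pair_sigma_finite) integrable_scaleR_product:
  fixes f :: "'a \<Rightarrow> real" and h :: "'b \<Rightarrow> 'c::{banach, second_countable_topology}"
  assumes f: "integrable M1 f" and h: "integrable M2 h"
  shows "integrable (M1 \<Otimes>\<^sub>M M2) (\<lambda>p. f (fst p) *\<^sub>R h (snd p))"
proof (rule Fubini_integrable)
  have [measurable]: "f \<in> borel_measurable M1" "h \<in> borel_measurable M2"
    using f h by auto
  show "(\<lambda>p. f (fst p) *\<^sub>R h (snd p)) \<in> borel_measurable (M1 \<Otimes>\<^sub>M M2)"
    by measurable
  have "(\<lambda>x. \<integral>y. norm (f x *\<^sub>R h y) \<partial>M2) = (\<lambda>x. \<bar>f x\<bar> * (\<integral>y. norm (h y) \<partial>M2))"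
    by simp
  thus "integrable M1 (\<lambda>x. \<integral>y. norm (f (fst (x, y)) *\<^sub>R h (snd (x, y))) \<partial>M2)"
    using f by simp
qed (use h in auto)

lemma (in pair_sigma_finite) integrable_mult_product:
  fixes f :: "'a \<Rightarrow> real" and h :: "'b \<Rightarrow> real"
  assumes "integrable M1 f" "integrable M2 h"
  shows "integrable (M1 \<Otimes>\<^sub>M M2) (\<lambda>p. f (fst p) * h (snd p))"
  using integrable_scaleR_product[OF assms] by simp

lemma (in pair_sigma_finite) integral_mult_product:
  fixes f :: "'a \<Rightarrow> real" and h :: "'b \<Rightarrow> real"
  assumes f: "integrable M1 f" and h: "integrable M2 h"
  shows "(\<integral>p. f (fst p) * h (snd p) \<partial>(M1 \<Otimes>\<^sub>M M2)) = (\<integral>s. f s \<partial>M1) * (\<integral>t. h t \<partial>M2)"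
  using integral_fst'[OF integrable_mult_product[OF assms]] by simp

text \<open>The Leibniz rule. The remainder splits into three terms, each a function of the first
  variable times a function of the second, so its L1 norm is a product of two integrals. Two terms
  contain a first-order remainder, the third is quadratic in the increment.\<close>

lemma (in pair_sigma_finite) L1_deriv_product:
  fixes \<phi> :: "'p::euclidean_space \<Rightarrow> 'a \<Rightarrow> real" and \<psi> :: "'p \<Rightarrow> 'b \<Rightarrow> real"
  assumes \<phi>: "L1_deriv M1 \<phi> g \<tau>" and \<psi>: "L1_deriv M2 \<psi> k \<tau>"
  shows "L1_deriv (M1 \<Otimes>\<^sub>M M2) (\<lambda>\<tau>' p. \<phi> \<tau>' (fst p) * \<psi> \<tau>' (snd p))
           (\<lambda>p. \<psi> \<tau> (snd p) *\<^sub>R g (fst p) + \<phi> \<tau> (fst p) *\<^sub>R k (snd p)) \<tau>"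
proof -
  note i\<phi> = L1_deriv_integrable[OF \<phi>] and i\<psi> = L1_deriv_integrable[OF \<psi>]
  have int: "\<forall>\<^sub>F \<tau>' in nhds \<tau>. integrable (M1 \<Otimes>\<^sub>M M2) (\<lambda>p. \<phi> \<tau>' (fst p) * \<psi> \<tau>' (snd p))"
    using i\<phi>(1) i\<psi>(1) by eventually_elim (rule integrable_mult_product)
  \<comment> \<open>In the first half of the gradient the scalar factor sits on the second
    coordinate, so the product is taken in the opposite order and then swapped.\<close>
  interpret sw: pair_sigma_finite M2 M1 ..
  have g1: "integrable (M1 \<Otimes>\<^sub>M M2) (\<lambda>p. \<psi> \<tau> (snd p) *\<^sub>R g (fst p))"
    using sw.integrable_product_swap[OF sw.integrable_scaleR_product[OF i\<psi>(3) i\<phi>(4)]]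
    by (simp add: case_prod_unfold)
  have g2: "integrable (M1 \<Otimes>\<^sub>M M2) (\<lambda>p. \<phi> \<tau> (fst p) *\<^sub>R k (snd p))"
    by (rule integrable_scaleR_product[OF i\<phi>(3) i\<psi>(4)])
  note gi = Bochner_Integration.integrable_add[OF g1 g2]
  define A where "A \<tau>' = (\<integral>s. \<bar>\<phi> \<tau>' s - \<phi> \<tau> s - g s \<bullet> (\<tau>' - \<tau>)\<bar> \<partial>M1)" for \<tau>'
  define B where "B \<tau>' = (\<integral>t. \<bar>\<psi> \<tau>' t - \<psi> \<tau> t - k t \<bullet> (\<tau>' - \<tau>)\<bar> \<partial>M2)" for \<tau>'
  define P where "P = (\<integral>s. \<bar>\<phi> \<tau> s\<bar> \<partial>M1)"
  define Q where "Q = (\<integral>t. \<bar>\<psi> \<tau> t\<bar> \<partial>M2)"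
  define Cg where "Cg = (\<integral>s. norm (g s) \<partial>M1)"
  define Ck where "Ck = (\<integral>t. norm (k t) \<partial>M2)"
  define E where "E \<tau>' p = \<phi> \<tau>' (fst p) * \<psi> \<tau>' (snd p) - \<phi> \<tau> (fst p) * \<psi> \<tau> (snd p)
      - (\<psi> \<tau> (snd p) *\<^sub>R g (fst p) + \<phi> \<tau> (fst p) *\<^sub>R k (snd p)) \<bullet> (\<tau>' - \<tau>)" for \<tau>' p
  define err where "err \<tau>' = (\<integral>p. \<bar>E \<tau>' p\<bar> \<partial>(M1 \<Otimes>\<^sub>M M2))" for \<tau>'
  have A: "((\<lambda>\<tau>'. A \<tau>' / norm (\<tau>' - \<tau>)) \<longlongrightarrow> 0) (at \<tau>)"
    and B: "((\<lambda>\<tau>'. B \<tau>' / norm (\<tau>' - \<tau>)) \<longlongrightarrow> 0) (at \<tau>)"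
    using \<phi> \<psi> by (auto simp: L1_deriv_def A_def B_def)
  \<comment> \<open>The bound is arranged so that every factor has a known limit: \<open>A\<close>
    and \<open>B\<close> appear only divided by the norm of the increment, and any spare power of
    that norm tends to 0.\<close>
  have le: "\<forall>\<^sub>F \<tau>' in at \<tau>. err \<tau>' / norm (\<tau>' - \<tau>) \<le>
      A \<tau>' / norm (\<tau>' - \<tau>) * (Q + (B \<tau>' / norm (\<tau>' - \<tau>) + Ck) * norm (\<tau>' - \<tau>)) + P * (B \<tau>' / norm (\<tau>' - \<tau>))
      + Cg * ((B \<tau>' / norm (\<tau>' - \<tau>) + Ck) * norm (\<tau>' - \<tau>))"
    using i\<phi>(2) i\<psi>(2) eventually_neq_at_within[of \<tau>]
  proof eventually_elim
    case (elim \<tau>')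
    define v where "v = \<tau>' - \<tau>"
    have v: "norm v > 0" using elim(3) by (simp add: v_def)
    define r where "r = (\<lambda>s. \<phi> \<tau>' s - \<phi> \<tau> s - g s \<bullet> v)"
    define q where "q = (\<lambda>t. \<psi> \<tau>' t - \<psi> \<tau> t - k t \<bullet> v)"
    define d where "d = (\<lambda>t. \<psi> \<tau>' t - \<psi> \<tau> t)"
    have ri: "integrable M1 r" and qi: "integrable M2 q" and di: "integrable M2 d"
      using elim i\<phi> i\<psi> by (auto simp: r_def q_def d_def)
    have gvi: "integrable M1 (\<lambda>s. g s \<bullet> v)" "integrable M2 (\<lambda>t. k t \<bullet> v)"
      using i\<phi> i\<psi> by auto
    have d_le: "(\<integral>t. \<bar>d t\<bar> \<partial>M2) \<le> B \<tau>' + Ck * norm v"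
    proof -
      have "(\<integral>t. \<bar>d t\<bar> \<partial>M2) \<le> (\<integral>t. \<bar>q t\<bar> + norm (k t) * norm v \<partial>M2)"
      proof (rule integral_mono)
        show "\<bar>d t\<bar> \<le> \<bar>q t\<bar> + norm (k t) * norm v" for t
          using Cauchy_Schwarz_ineq2[of "k t" v] by (simp add: d_def q_def)
      qed (use di qi i\<psi>(4) in auto)
      also have "\<dots> = B \<tau>' + Ck * norm v"
        using qi i\<psi>(4) by (simp add: B_def Ck_def q_def v_def)
      finally show ?thesis .
    qed
    have psi_le: "(\<integral>t. \<bar>\<psi> \<tau>' t\<bar> \<partial>M2) \<le> Q + (B \<tau>' + Ck * norm v)"
    proof -
      have "(\<integral>t. \<bar>\<psi> \<tau>' t\<bar> \<partial>M2) \<le> (\<integral>t. \<bar>\<psi> \<tau> t\<bar> + \<bar>d t\<bar> \<partial>M2)"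
        by (rule integral_mono) (use elim i\<psi> di in \<open>auto simp: d_def\<close>)
      also have "\<dots> = Q + (\<integral>t. \<bar>d t\<bar> \<partial>M2)"
        using i\<psi> di by (simp add: Q_def)
      finally show ?thesis using d_le by simp
    qed
    have gv_le: "(\<integral>s. \<bar>g s \<bullet> v\<bar> \<partial>M1) \<le> Cg * norm v"
    proof -
      have "(\<integral>s. \<bar>g s \<bullet> v\<bar> \<partial>M1) \<le> (\<integral>s. norm (g s) * norm v \<partial>M1)"
        by (rule integral_mono) (use i\<phi> Cauchy_Schwarz_ineq2 in auto)
      thus ?thesis by (simp add: Cg_def)
    qed
    note pint = integrable_abs[OF integrable_mult_product]
    have pabs: "(\<integral>p. \<bar>a (fst p) * b (snd p)\<bar> \<partial>(M1 \<Otimes>\<^sub>M M2)) = (\<integral>s. \<bar>a s\<bar> \<partial>M1) * (\<integral>t. \<bar>b t\<bar> \<partial>M2)"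
      if "integrable M1 a" "integrable M2 b" for a b :: "_ \<Rightarrow> real"
      using integral_mult_product[OF integrable_abs[OF that(1)] integrable_abs[OF that(2)]]
      by (simp add: abs_mult)
    \<comment> \<open>Write the new values as \<phi> + g.v + r and \<psi> + k.v + q and expand,
      keeping the new \<psi> undivided next to \<open>r\<close> and the increment \<open>d\<close>
      next to g.v.\<close>
    have E_eq: "E \<tau>' p = r (fst p) * \<psi> \<tau>' (snd p) + \<phi> \<tau> (fst p) * q (snd p) + (g (fst p) \<bullet> v) * d (snd p)" for p
      by (simp add: E_def r_def q_def d_def v_def inner_add_left algebra_simps)
    have "err \<tau>' \<le> (\<integral>p. \<bar>r (fst p) * \<psi> \<tau>' (snd p)\<bar> + \<bar>\<phi> \<tau> (fst p) * q (snd p)\<bar>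
        + \<bar>(g (fst p) \<bullet> v) * d (snd p)\<bar> \<partial>(M1 \<Otimes>\<^sub>M M2))"
      unfolding err_def
    proof (rule integral_mono)
      show "\<bar>E \<tau>' p\<bar> \<le> \<bar>r (fst p) * \<psi> \<tau>' (snd p)\<bar> + \<bar>\<phi> \<tau> (fst p) * q (snd p)\<bar> + \<bar>(g (fst p) \<bullet> v) * d (snd p)\<bar>" for p
        unfolding E_eq by linarith
      show "integrable (M1 \<Otimes>\<^sub>M M2) (\<lambda>p. \<bar>E \<tau>' p\<bar>)"
        unfolding E_eq
        by (intro integrable_abs Bochner_Integration.integrable_add integrable_mult_product ri qi di gvi elim i\<phi>)
      show "integrable (M1 \<Otimes>\<^sub>M M2) (\<lambda>p. \<bar>r (fst p) * \<psi> \<tau>' (snd p)\<bar> + \<bar>\<phi> \<tau> (fst p) * q (snd p)\<bar>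
        + \<bar>(g (fst p) \<bullet> v) * d (snd p)\<bar>)"
        by (intro Bochner_Integration.integrable_add pint ri qi di gvi elim i\<phi>)
    qed
    also have "\<dots> = (\<integral>s. \<bar>r s\<bar> \<partial>M1) * (\<integral>t. \<bar>\<psi> \<tau>' t\<bar> \<partial>M2) + P * (\<integral>t. \<bar>q t\<bar> \<partial>M2)
        + (\<integral>s. \<bar>g s \<bullet> v\<bar> \<partial>M1) * (\<integral>t. \<bar>d t\<bar> \<partial>M2)"
      unfolding P_def pabs[OF ri elim(2), symmetric] pabs[OF i\<phi>(3) qi, symmetric]
        pabs[OF gvi(1) di, symmetric]
      by (intro trans[OF Bochner_Integration.integral_add] arg_cong2[where f = "(+)"] refl
          Bochner_Integration.integrable_add pint ri qi di gvi elim i\<phi>)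
    also have "\<dots> \<le> A \<tau>' * (Q + (B \<tau>' + Ck * norm v)) + P * B \<tau>' + (Cg * norm v) * (B \<tau>' + Ck * norm v)"
      using psi_le gv_le d_le
      by (intro add_mono mult_mono) (auto simp: A_def B_def P_def Cg_def r_def q_def v_def)
    finally have "err \<tau>' / norm v \<le> (A \<tau>' * (Q + (B \<tau>' + Ck * norm v)) + P * B \<tau>' + (Cg * norm v) * (B \<tau>' + Ck * norm v)) / norm v"
      using v by (simp add: divide_right_mono)
    also have "\<dots> = A \<tau>' / norm v * (Q + (B \<tau>' / norm v + Ck) * norm v) + P * (B \<tau>' / norm v)
      + Cg * ((B \<tau>' / norm v + Ck) * norm v)"
      using v by (simp add: field_simps)
    finally show ?case by (simp add: v_def)
  qed
  have n0: "((\<lambda>\<tau>'. norm (\<tau>' - \<tau>)) \<longlongrightarrow> 0) (at \<tau>)"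
    using tendsto_norm_zero[OF LIM_zero[OF tendsto_ident_at]] .
  have "((\<lambda>\<tau>'. A \<tau>' / norm (\<tau>' - \<tau>) * (Q + (B \<tau>' / norm (\<tau>' - \<tau>) + Ck) * norm (\<tau>' - \<tau>)) + P * (B \<tau>' / norm (\<tau>' - \<tau>))
      + Cg * ((B \<tau>' / norm (\<tau>' - \<tau>) + Ck) * norm (\<tau>' - \<tau>))) \<longlongrightarrow> 0 * (Q + (0 + Ck) * 0) + P * 0 + Cg * ((0 + Ck) * 0)) (at \<tau>)"
    by (intro tendsto_intros A B n0)
  hence lim: "((\<lambda>\<tau>'. A \<tau>' / norm (\<tau>' - \<tau>) * (Q + (B \<tau>' / norm (\<tau>' - \<tau>) + Ck) * norm (\<tau>' - \<tau>)) + P * (B \<tau>' / norm (\<tau>' - \<tau>))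
      + Cg * ((B \<tau>' / norm (\<tau>' - \<tau>) + Ck) * norm (\<tau>' - \<tau>))) \<longlongrightarrow> 0) (at \<tau>)"
    by simp
  have "((\<lambda>\<tau>'. err \<tau>' / norm (\<tau>' - \<tau>)) \<longlongrightarrow> 0) (at \<tau>)"
    by (rule tendsto_sandwich[OF _ le tendsto_const lim]) (simp add: err_def)
  thus ?thesis
    using int gi by (simp add: L1_deriv_def err_def E_def)
qed

section \<open>Images of integrable functions under Markov kernels\<close>

lemma integrable_pmf_scaleR:
  fixes r :: "'s \<Rightarrow> 'b::{banach, second_countable_topology}" and K :: "'s \<Rightarrow> 'y::countable pmf"
  assumes r: "integrable M r" and K: "\<And>y. (\<lambda>s. pmf (K s) y) \<in> borel_measurable M"
  shows "integrable M (\<lambda>s. pmf (K s) y *\<^sub>R r s)"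
  by (rule Bochner_Integration.integrable_bound[OF r])
     (use r K[of y] in \<open>auto simp: mult_left_le_one_le pmf_le_1\<close>)

text \<open>A Markov kernel is a contraction of L1: pull the norm inside the integral, exchange sum
  and integral by Tonelli, and use that each \<open>K s\<close> has total mass 1.\<close>

lemma
  fixes r :: "'s \<Rightarrow> 'b::{banach, second_countable_topology}" and K :: "'s \<Rightarrow> 'y::countable pmf"
  assumes r: "integrable M r" and K: "\<And>y. (\<lambda>s. pmf (K s) y) \<in> borel_measurable M"
  shows integrable_kernel: "integrable (count_space UNIV) (\<lambda>y. \<integral>s. pmf (K s) y *\<^sub>R r s \<partial>M)"
    and integral_norm_kernel_le:
      "(\<integral>y. norm (\<integral>s. pmf (K s) y *\<^sub>R r s \<partial>M) \<partial>count_space UNIV) \<le> (\<integral>s. norm (r s) \<partial>M)"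
proof -
  note [measurable] = K borel_measurable_integrable[OF r]
  have "(\<integral>\<^sup>+y. norm (\<integral>s. pmf (K s) y *\<^sub>R r s \<partial>M) \<partial>count_space UNIV)
      \<le> (\<integral>\<^sup>+y. (\<integral>\<^sup>+s. ennreal (pmf (K s) y) * ennreal (norm (r s)) \<partial>M) \<partial>count_space UNIV)"
    by (intro nn_integral_mono order_trans[OF integral_norm_bound_ennreal] integrable_pmf_scaleR r K)
       (simp add: ennreal_mult)
  also have "\<dots> = (\<integral>\<^sup>+s. (\<integral>\<^sup>+y. ennreal (pmf (K s) y) * ennreal (norm (r s)) \<partial>count_space UNIV) \<partial>M)"
    by (subst nn_integral_count_space_nn_integral) auto
  also have "\<dots> = (\<integral>\<^sup>+s. norm (r s) \<partial>M)"
    by (simp add: nn_integral_multc nn_integral_pmf')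
  also have "\<dots> = ennreal (\<integral>s. norm (r s) \<partial>M)"
    using r by (intro nn_integral_eq_integral) auto
  finally have le: "(\<integral>\<^sup>+y. norm (\<integral>s. pmf (K s) y *\<^sub>R r s \<partial>M) \<partial>count_space UNIV)
      \<le> ennreal (\<integral>s. norm (r s) \<partial>M)" .
  show int: "integrable (count_space UNIV) (\<lambda>y. \<integral>s. pmf (K s) y *\<^sub>R r s \<partial>M)"
    using le by (intro integrableI_bounded) (auto simp: top_unique intro: order_le_less_trans)
  show "(\<integral>y. norm (\<integral>s. pmf (K s) y *\<^sub>R r s \<partial>M) \<partial>count_space UNIV) \<le> (\<integral>s. norm (r s) \<partial>M)"
    using le int by (subst (asm) nn_integral_eq_integral) auto
qed

text \<open>The kernel is linear and does not involve the parameter, so the remainder of the image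
  is the image of the remainder, and the contraction property bounds it.\<close>

lemma L1_deriv_kernel:
  fixes K :: "'s \<Rightarrow> 'y::countable pmf"
  assumes \<phi>: "L1_deriv M \<phi> g \<tau>" and K: "\<And>y. (\<lambda>s. pmf (K s) y) \<in> borel_measurable M"
  shows "L1_deriv (count_space UNIV) (\<lambda>\<tau>' y. \<integral>s. pmf (K s) y * \<phi> \<tau>' s \<partial>M)
           (\<lambda>y. \<integral>s. pmf (K s) y *\<^sub>R g s \<partial>M) \<tau>"
proof -
  note i\<phi> = L1_deriv_integrable[OF \<phi>]
  let ?\<psi> = "\<lambda>\<tau>' y. \<integral>s. pmf (K s) y * \<phi> \<tau>' s \<partial>M"
  let ?k = "\<lambda>y. \<integral>s. pmf (K s) y *\<^sub>R g s \<partial>M"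
  have int: "\<forall>\<^sub>F \<tau>' in nhds \<tau>. integrable (count_space UNIV) (?\<psi> \<tau>')"
    using i\<phi>(1)
  proof eventually_elim
    case (elim \<tau>')
    show ?case using integrable_kernel[OF elim K] by simp
  qed
  have le: "\<forall>\<^sub>F \<tau>' in at \<tau>.
      (\<integral>y. \<bar>?\<psi> \<tau>' y - ?\<psi> \<tau> y - ?k y \<bullet> (\<tau>' - \<tau>)\<bar> \<partial>count_space UNIV) / norm (\<tau>' - \<tau>)
      \<le> (\<integral>s. \<bar>\<phi> \<tau>' s - \<phi> \<tau> s - g s \<bullet> (\<tau>' - \<tau>)\<bar> \<partial>M) / norm (\<tau>' - \<tau>)"
    using i\<phi>(2)
  proof eventually_elim
    case (elim \<tau>')
    define r where "r = (\<lambda>s. \<phi> \<tau>' s - \<phi> \<tau> s - g s \<bullet> (\<tau>' - \<tau>))"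
    have r: "integrable M r"
      unfolding r_def using elim i\<phi> by auto
    have "?\<psi> \<tau>' y - ?\<psi> \<tau> y - ?k y \<bullet> (\<tau>' - \<tau>) = (\<integral>s. pmf (K s) y *\<^sub>R r s \<partial>M)" for y
    proof -
      have i: "integrable M (\<lambda>s. pmf (K s) y * \<phi> \<tau>' s)" "integrable M (\<lambda>s. pmf (K s) y * \<phi> \<tau> s)"
        using integrable_pmf_scaleR[OF _ K] elim i\<phi> by (auto simp del: real_scaleR_def simp flip: real_scaleR_def)
      have k: "integrable M (\<lambda>s. pmf (K s) y *\<^sub>R g s)"
        by (rule integrable_pmf_scaleR[OF i\<phi>(4) K])
      have "?k y \<bullet> (\<tau>' - \<tau>) = (\<integral>s. (pmf (K s) y *\<^sub>R g s) \<bullet> (\<tau>' - \<tau>) \<partial>M)"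
        using k by (simp only: integral_inner_left)
      moreover have "integrable M (\<lambda>s. (pmf (K s) y *\<^sub>R g s) \<bullet> (\<tau>' - \<tau>))"
        using k by (rule integrable_inner_left)
      ultimately show ?thesis
        using i by (simp add: r_def right_diff_distrib)
    qed
    hence "(\<integral>y. \<bar>?\<psi> \<tau>' y - ?\<psi> \<tau> y - ?k y \<bullet> (\<tau>' - \<tau>)\<bar> \<partial>count_space UNIV) \<le> (\<integral>s. \<bar>r s\<bar> \<partial>M)"
      using integral_norm_kernel_le[OF r K] by simp
    thus ?case
      by (simp add: r_def divide_right_mono)
  qed
  have "((\<lambda>\<tau>'. (\<integral>y. \<bar>?\<psi> \<tau>' y - ?\<psi> \<tau> y - ?k y \<bullet> (\<tau>' - \<tau>)\<bar> \<partial>count_space UNIV) / norm (\<tau>' - \<tau>))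
      \<longlongrightarrow> 0) (at \<tau>)"
    by (rule tendsto_sandwich[OF _ le tendsto_const]) (use \<phi> in \<open>auto simp: L1_deriv_def\<close>)
  thus ?thesis
    using int integrable_kernel[OF i\<phi>(4) K] by (simp add: L1_deriv_def)
qed

section \<open>From L1 over a discrete space back to single entries\<close>

lemma norm_le_integral_count_space:
  fixes f :: "'y \<Rightarrow> real"
  assumes "integrable (count_space UNIV) f"
  shows "\<bar>f y\<bar> \<le> (\<integral>x. \<bar>f x\<bar> \<partial>count_space UNIV)"
proof -
  have "{x. indicator {y} x \<noteq> (0::real) \<and> f x \<noteq> 0} = (if f y = 0 then {} else {y})"
    by (auto simp: indicator_def)
  hence "\<bar>f y\<bar> = (\<integral>x. \<bar>f x\<bar> * indicator {y} x \<partial>count_space UNIV)"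
    by (subst lebesgue_integral_count_space_finite_support) (auto simp: conj_commute)
  also have "\<dots> \<le> (\<integral>x. \<bar>f x\<bar> \<partial>count_space UNIV)"
    using assms by (intro integral_mono integrable_real_mult_indicator) (auto simp: indicator_def)
  finally show ?thesis .
qed

text \<open>Every point has mass 1 under the counting measure, so the remainder at \<open>y\<close>
  is at most the L1 norm of the remainder.\<close>

lemma L1_deriv_count_space_has_derivative:
  assumes "L1_deriv (count_space UNIV) \<phi> g \<tau>"
  shows "((\<lambda>\<tau>'. \<phi> \<tau>' y) has_derivative (\<lambda>v. g y \<bullet> v)) (at \<tau>)"
proof -
  note i\<phi> = L1_deriv_integrable[OF assms]
  have le: "\<forall>\<^sub>F \<tau>' in at \<tau>. norm (\<phi> \<tau>' y - \<phi> \<tau> y - g y \<bullet> (\<tau>' - \<tau>)) / norm (\<tau>' - \<tau>)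
      \<le> (\<integral>y. \<bar>\<phi> \<tau>' y - \<phi> \<tau> y - g y \<bullet> (\<tau>' - \<tau>)\<bar> \<partial>count_space UNIV) / norm (\<tau>' - \<tau>)"
    using i\<phi>(2)
  proof eventually_elim
    case (elim \<tau>')
    have "integrable (count_space UNIV) (\<lambda>y. \<phi> \<tau>' y - \<phi> \<tau> y - g y \<bullet> (\<tau>' - \<tau>))"
      using elim i\<phi> by auto
    from norm_le_integral_count_space[OF this, of y] show ?case
      by (simp add: divide_right_mono)
  qed
  have "((\<lambda>\<tau>'. norm (\<phi> \<tau>' y - \<phi> \<tau> y - g y \<bullet> (\<tau>' - \<tau>)) / norm (\<tau>' - \<tau>)) \<longlongrightarrow> 0) (at \<tau>)"
    by (rule tendsto_sandwich[OF _ le tendsto_const]) (use assms in \<open>auto simp: L1_deriv_def\<close>)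
  thus ?thesis
    by (simp add: has_derivative_iff_norm bounded_linear_inner_right)
qed

subsection \<open>The Beta prime density\<close>

definition beta_prime_density :: "real \<Rightarrow> real \<Rightarrow> real \<Rightarrow> real" where
  "beta_prime_density l m x =
     indicator {0<..} x * (x powr (m - 1) * (1 + x) powr (- m - l - 1) / Beta m (l + 1))"

lemma beta_prime_eq: "beta_prime m l = density lborel (\<lambda>x. ennreal (beta_prime_density l m x))"
  by (simp add: beta_prime_def beta_prime_density_def)

lemma borel_measurable_beta_prime_density [measurable]: "beta_prime_density l m \<in> borel_measurable borel"
  unfolding beta_prime_density_def by measurable

lemma Beta_real_pos: "0 < a \<Longrightarrow> 0 < b \<Longrightarrow> 0 < Beta a (b::real)"
  by (simp add: Beta_def)

lemma beta_prime_density_nonneg: "0 < m \<Longrightarrow> 0 < l \<Longrightarrow> 0 \<le> beta_prime_density l m x"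
  using Beta_real_pos[of m "l + 1"] by (simp add: beta_prime_density_def)

text \<open>Below 1 the second power is at most 1, which leaves \<open>x powr (m - 1)\<close>,
  integrable at 0 because \<open>m\<close> is positive. Beyond 1, replacing \<open>1 + x\<close> by
  \<open>x\<close> leaves \<open>x powr (- l - 2)\<close>.\<close>

lemma integrable_beta_prime_kernel:
  fixes m l :: real
  assumes m: "0 < m" and l: "0 < l"
  shows "integrable lborel (\<lambda>x. indicator {0<..} x * (x powr (m - 1) * (1 + x) powr (- m - l - 1)))"
proof -
  have i1: "integrable lborel (\<lambda>x::real. indicator {0..1} x *\<^sub>R x powr (m - 1))"
  proof -
    have "(\<lambda>x. x powr (m - 1)) absolutely_integrable_on {0..1}"
      using m by (intro nonnegative_absolutely_integrable_1 integrable_on_powr_from_0) auto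
    thus ?thesis
      by (simp add: set_integrable_def integrable_completion)
  qed
  have i2: "integrable lborel (\<lambda>x::real. indicator {1..} x *\<^sub>R x powr (- l - 2))"
  proof -
    have "(\<lambda>x. x powr (- l - 2)) absolutely_integrable_on {1..}"
      using l has_integral_powr_to_inf[of "- l - 2" 1]
      by (intro nonnegative_absolutely_integrable_1) (auto simp: integrable_on_def)
    thus ?thesis
      by (simp add: set_integrable_def integrable_completion)
  qed
  show ?thesis
  proof (rule Bochner_Integration.integrable_bound[OF Bochner_Integration.integrable_add[OF i1 i2]])
    show "AE x in lborel. norm (indicator {0<..} x * (x powr (m - 1) * (1 + x) powr (- m - l - 1)))
      \<le> norm (indicator {0..1} x *\<^sub>R x powr (m - 1) + indicator {1..} x *\<^sub>R x powr (- l - 2))"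
    proof (rule AE_I2)
      fix x :: real
      consider "x \<le> 0" | "0 < x" "x < 1" | "1 \<le> x" by linarith
      thus "norm (indicator {0<..} x * (x powr (m - 1) * (1 + x) powr (- m - l - 1)))
        \<le> norm (indicator {0..1} x *\<^sub>R x powr (m - 1) + indicator {1..} x *\<^sub>R x powr (- l - 2))"
      proof cases
        case 2
        have "(1 + x) powr (- m - l - 1) \<le> (1 + x) powr 0"
          using 2 m l by (intro powr_mono) auto
        hence "x powr (m - 1) * (1 + x) powr (- m - l - 1) \<le> x powr (m - 1) * 1"
          using 2 by (intro mult_left_mono) auto
        thus ?thesis using 2 by simp
      next
        case 3
        have "(1 + x) powr (- m - l - 1) \<le> x powr (- m - l - 1)"
          using 3 m l by (intro powr_mono2') auto
        hence "x powr (m - 1) * (1 + x) powr (- m - l - 1) \<le> x powr (m - 1) * x powr (- m - l - 1)"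
          by (intro mult_left_mono) auto
        also have "\<dots> = x powr (- l - 2)"
          by (simp add: algebra_simps flip: powr_add)
        finally have "x powr (m - 1) * (1 + x) powr (- m - l - 1) \<le> x powr (- l - 2)" .
        thus ?thesis using 3 by (simp add: add_increasing)
      qed simp
    qed
  qed measurable
qed

lemma integrable_beta_prime_density:
  "0 < m \<Longrightarrow> 0 < l \<Longrightarrow> integrable lborel (beta_prime_density l m)"
  using integrable_divide_zero[OF integrable_beta_prime_kernel[of m l], of "Beta m (l + 1)"]
  unfolding beta_prime_density_def by simp

text \<open>For positive \<open>x\<close> this is the derivative of the log density in
  \<open>m\<close>: the two powers contribute the logarithms, the normalising Beta function the
  Digamma difference.\<close>

definition beta_prime_score :: "real \<Rightarrow> real \<Rightarrow> real \<Rightarrow> real" where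
  "beta_prime_score l m x = ln x - ln (1 + x) - (Digamma m - Digamma (m + l + 1))"

lemma pos_not_nonpos_Ints: "0 < (x::real) \<Longrightarrow> x \<notin> \<int>\<^sub>\<le>\<^sub>0"
  by (auto dest: nonpos_Ints_nonpos)

lemma has_field_derivative_beta_prime_density:
  assumes m: "0 < m" and l: "0 < l"
  shows "((\<lambda>m. beta_prime_density l m x) has_field_derivative
           beta_prime_density l m x * beta_prime_score l m x) (at m)"
proof (cases "0 < x")
  case True
  have B: "Beta m (l + 1) \<noteq> 0" using Beta_real_pos[of m "l + 1"] m l by simp
  have d1: "((\<lambda>m. x powr (m - 1)) has_field_derivative x powr (m - 1) * ln x) (at m)"
    using True by (auto simp: powr_def intro!: derivative_eq_intros)
  have d2: "((\<lambda>m. (1 + x) powr (- m - l - 1)) has_field_derivative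
      - ((1 + x) powr (- m - l - 1) * ln (1 + x))) (at m)"
    using True by (auto simp: powr_def intro!: derivative_eq_intros)
  have d3: "((\<lambda>m. Beta m (l + 1)) has_field_derivative
      Beta m (l + 1) * (Digamma m - Digamma (m + (l + 1)))) (at m)"
    using m l by (intro has_field_derivative_Beta1 pos_not_nonpos_Ints) auto
  have "((\<lambda>m. x powr (m - 1) * (1 + x) powr (- m - l - 1) / Beta m (l + 1)) has_field_derivative
      x powr (m - 1) * (1 + x) powr (- m - l - 1) / Beta m (l + 1) * beta_prime_score l m x) (at m)"
    by (rule DERIV_cong[OF DERIV_divide[OF DERIV_mult[OF d1 d2] d3 B]])
       (use B in \<open>simp add: beta_prime_score_def divide_simps add_ac; simp add: algebra_simps\<close>)
  thus ?thesis using True by (simp add: beta_prime_density_def)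
qed (simp add: beta_prime_density_def)

text \<open>Trades the logarithmic singularity at 0 for an arbitrarily small power, through
  \<open>ln y \<le> y powr \<epsilon> / \<epsilon>\<close>.\<close>

lemma beta_prime_score_bound:
  assumes \<epsilon>: "0 < \<epsilon>" and x: "0 < (x::real)"
  shows "\<bar>ln x - ln (1 + x)\<bar> \<le> ((1 + x) / x) powr \<epsilon> / \<epsilon>"
proof -
  have "\<bar>ln x - ln (1 + x)\<bar> = ln ((1 + x) / x)"
    using x by (simp add: ln_div)
  also have "\<dots> \<le> ((1 + x) / x) powr \<epsilon> / \<epsilon>"
    using x \<epsilon> by (intro ln_powr_bound) auto
  finally show ?thesis .
qed

text \<open>On \<open>m \<ge> 2 \<epsilon>\<close> the power \<open>(x / (1 + x)) powr m\<close> absorbs the logarithm in the score at the cost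
  of \<open>(x / (1 + x)) powr \<epsilon>\<close>, so that the kernel with parameter \<open>\<epsilon>\<close> dominates.\<close>

lemma beta_prime_derivative_dominated:
  assumes \<epsilon>: "0 < \<epsilon>" and l: "0 < l"
  obtains C where "\<And>m x. m \<in> {2 * \<epsilon>..c} \<Longrightarrow> \<bar>beta_prime_density l m x * beta_prime_score l m x\<bar>
    \<le> C * (indicator {0<..} x * (x powr (\<epsilon> - 1) * (1 + x) powr (- \<epsilon> - l - 1)))"
proof -
  let ?I = "{2 * \<epsilon>..c}"
  have nz: "m \<notin> \<int>\<^sub>\<le>\<^sub>0" "m + l + 1 \<notin> \<int>\<^sub>\<le>\<^sub>0" "m + (l + 1) \<notin> \<int>\<^sub>\<le>\<^sub>0" if "m \<in> ?I" for m
    using that \<epsilon> l by (auto intro!: pos_not_nonpos_Ints)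
  have pos: "0 < Beta m (l + 1)" if "m \<in> ?I" for m
    using that \<epsilon> l by (intro Beta_real_pos) auto
  \<comment> \<open>The interval is compact and the arguments stay away from the poles of Gamma, so
    the inverse of Beta and the Digamma difference are bounded on it, by \<open>A\<close> and
    \<open>B\<close>.\<close>
  have cB: "continuous_on ?I (\<lambda>m. Beta m (l + 1))"
    using nz by (intro DERIV_continuous_on[OF has_field_derivative_Beta1]) auto
  have "continuous_on ?I (\<lambda>m. inverse (Beta m (l + 1)))"
    using pos by (intro continuous_on_inverse cB) (metis less_irrefl)
  hence "bounded ((\<lambda>m. inverse (Beta m (l + 1))) ` ?I)"
    by (intro compact_imp_bounded compact_continuous_image) auto
  then obtain A where "\<forall>y\<in>(\<lambda>m. inverse (Beta m (l + 1))) ` ?I. norm y \<le> A"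
    unfolding bounded_iff by blast
  hence A: "\<bar>inverse (Beta m (l + 1))\<bar> \<le> A" if "m \<in> ?I" for m
    using that by auto
  have "continuous_on ?I (\<lambda>m. Digamma m - Digamma (m + l + 1))"
    using nz by (intro continuous_on_diff continuous_on_Polygamma
        continuous_on_compose2[OF continuous_on_Polygamma[of "(\<lambda>m. m + l + 1) ` ?I"]] continuous_intros) auto
  hence "bounded ((\<lambda>m. Digamma m - Digamma (m + l + 1)) ` ?I)"
    by (intro compact_imp_bounded compact_continuous_image) auto
  then obtain B where "\<forall>y\<in>(\<lambda>m. Digamma m - Digamma (m + l + 1)) ` ?I. norm y \<le> B"
    unfolding bounded_iff by blast
  hence B: "\<bar>Digamma m - Digamma (m + l + 1)\<bar> \<le> B" if "m \<in> ?I" for m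
    using that by auto
  show ?thesis
  proof (rule that[of "A * (1 / \<epsilon> + B)"])
    fix m x assume m: "m \<in> ?I"
    show "\<bar>beta_prime_density l m x * beta_prime_score l m x\<bar>
      \<le> A * (1 / \<epsilon> + B) * (indicator {0<..} x * (x powr (\<epsilon> - 1) * (1 + x) powr (- \<epsilon> - l - 1)))"
    proof (cases "0 < x")
      case True
      \<comment> \<open>Apart from the Beta function, the density depends on \<open>m\<close> only
        through \<open>q powr m\<close>, and \<open>q\<close> lies in (0, 1].\<close>
      define q where "q = x / (1 + x)"
      have q: "0 < q" "q \<le> 1" using True by (auto simp: q_def)
      have kernel: "x powr (m' - 1) * (1 + x) powr (- m' - l - 1) = q powr m' * (x powr (-1) * (1 + x) powr (- l - 1))" for m'
        using True by (simp add: q_def powr_divide powr_minus powr_diff powr_add field_simps)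
      have "\<bar>beta_prime_score l m x\<bar> \<le> ((1 + x) / x) powr \<epsilon> / \<epsilon> + B"
        using beta_prime_score_bound[OF \<epsilon> True] B[OF m] unfolding beta_prime_score_def by linarith
      also have "(1 + x) / x = inverse q" by (simp add: q_def)
      also have "inverse q powr \<epsilon> = q powr (- \<epsilon>)"
        using q by (simp add: powr_minus inverse_powr)
      finally have "q powr m * \<bar>beta_prime_score l m x\<bar> \<le> q powr m * (q powr (- \<epsilon>) / \<epsilon> + B)"
        by (intro mult_left_mono) auto
      also have "\<dots> = q powr (m - \<epsilon>) / \<epsilon> + q powr m * B"
        using q by (simp add: powr_diff powr_minus field_simps)
      \<comment> \<open>Both exponents, \<open>m - \<epsilon>\<close> and \<open>m\<close>, are at
        least \<epsilon> because \<open>m\<close> is at least 2 \<epsilon>, and powers of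
        \<open>q\<close> decrease in the exponent.\<close>
      also have "\<dots> \<le> q powr \<epsilon> / \<epsilon> + q powr \<epsilon> * B"
        using q m \<epsilon> B[OF m]
        by (intro add_mono divide_right_mono mult_right_mono powr_mono') auto
      finally have s: "q powr m * \<bar>beta_prime_score l m x\<bar> \<le> q powr \<epsilon> * (1 / \<epsilon> + B)"
        by (simp add: algebra_simps)
      define w where "w = x powr (-1) * (1 + x) powr (- l - 1)"
      have w: "0 \<le> w" by (simp add: w_def)
      have "\<bar>beta_prime_density l m x * beta_prime_score l m x\<bar>
          = \<bar>inverse (Beta m (l + 1))\<bar> * w * (q powr m * \<bar>beta_prime_score l m x\<bar>)"
        using True by (simp add: beta_prime_density_def kernel w_def abs_mult divide_inverse mult_ac)
      also have "\<dots> \<le> A * w * (q powr \<epsilon> * (1 / \<epsilon> + B))"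
        by (intro mult_mono[OF mult_right_mono[OF A[OF m] w] s] mult_nonneg_nonneg w)
           (use order_trans[OF abs_ge_zero A[OF m]] in auto)
      also have "\<dots> = A * (1 / \<epsilon> + B) * (q powr \<epsilon> * w)" by (simp add: mult_ac)
      finally show ?thesis
        using True by (simp add: kernel w_def)
    qed (simp add: beta_prime_density_def)
  qed
qed

lemma L1_deriv_beta_prime_density:
  fixes \<tau> :: "real ^ 'k::finite"
  assumes m: "0 < \<tau> $ k" and l: "0 < l"
  shows "\<exists>g. L1_deriv lborel (\<lambda>\<tau>'. beta_prime_density l (\<tau>' $ k)) g \<tau>"
proof -
  \<comment> \<open>With this choice 2 \<epsilon> is half the true coefficient, so \<open>U\<close>
    is a neighbourhood of \<tau> on which the coefficient stays away from 0. The upper limit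
    \<open>\<tau> $ k + 1\<close> serves to make the parameter interval compact.\<close>
  define \<epsilon> where "\<epsilon> = \<tau> $ k / 4"
  have \<epsilon>: "0 < \<epsilon>" using m by (simp add: \<epsilon>_def)
  define U where "U = {\<tau>' :: real ^ 'k. 2 * \<epsilon> < \<tau>' $ k} \<inter> {\<tau>'. \<tau>' $ k < \<tau> $ k + 1}"
  obtain C where C: "\<And>m x. m \<in> {2 * \<epsilon>..\<tau> $ k + 1} \<Longrightarrow> \<bar>beta_prime_density l m x * beta_prime_score l m x\<bar>
    \<le> C * (indicator {0<..} x * (x powr (\<epsilon> - 1) * (1 + x) powr (- \<epsilon> - l - 1)))"
    using beta_prime_derivative_dominated[OF \<epsilon> l] by blast
  have "open U"
    unfolding U_def by (intro open_Int open_Collect_less continuous_intros)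
  define g where "g \<tau>' x = (beta_prime_density l (\<tau>' $ k) x * beta_prime_score l (\<tau>' $ k) x) *\<^sub>R (axis k 1 :: real ^ 'k)"
    for \<tau>' :: "real ^ 'k" and x :: real
  have "L1_deriv lborel (\<lambda>\<tau>'. beta_prime_density l (\<tau>' $ k)) (g \<tau>) \<tau>"
  proof (rule L1_deriv_dominated)
    show "open U" by fact
    show "\<tau> \<in> U" using m by (simp add: U_def \<epsilon>_def)
    show "integrable lborel (beta_prime_density l (\<tau>' $ k))" if "\<tau>' \<in> U" for \<tau>'
      using that \<epsilon> l by (intro integrable_beta_prime_density) (auto simp: U_def)
    show "((\<lambda>\<tau>. beta_prime_density l (\<tau> $ k) s) has_derivative (\<lambda>v. g \<tau>' s \<bullet> v)) (at \<tau>')"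
      if "\<tau>' \<in> U" for \<tau>' s
    proof -
      have "0 < \<tau>' $ k" using that \<epsilon> by (auto simp: U_def)
      from has_field_derivative_beta_prime_density[OF this l, of s]
      have "((\<lambda>m. beta_prime_density l m s) has_derivative
          (*) (beta_prime_density l (\<tau>' $ k) s * beta_prime_score l (\<tau>' $ k) s)) (at (\<tau>' $ k))"
        by (simp add: has_field_derivative_def)
      from has_derivative_compose[OF bounded_linear.has_derivative[OF bounded_linear_vec_nth has_derivative_ident] this]
      show ?thesis by (simp add: g_def inner_axis')
    qed
    show "norm (g \<tau>' s) \<le> C * (indicator {0<..} s * (s powr (\<epsilon> - 1) * (1 + s) powr (- \<epsilon> - l - 1)))"
      if "\<tau>' \<in> U" for \<tau>' s
      using C[of "\<tau>' $ k" s] that by (simp add: g_def U_def)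
    show "integrable lborel (\<lambda>s. C * (indicator {0<..} s * (s powr (\<epsilon> - 1) * (1 + s) powr (- \<epsilon> - l - 1))))"
      using integrable_beta_prime_kernel[OF \<epsilon> l] by (rule integrable_mult_right)
    show "g \<tau> \<in> borel_measurable lborel"
      unfolding g_def beta_prime_score_def by measurable
  qed
  thus ?thesis by blast
qed

subsection \<open>The Markov property\<close>

text \<open>Real summability is absolute, and both sides default to 0 when it fails, so the equation
  holds without side condition.\<close>

lemma infsum_eq_integral_count_space:
  fixes f :: "'b \<Rightarrow> real"
  shows "infsum f UNIV = (\<integral>x. f x \<partial>count_space UNIV)"
proof (cases "integrable (count_space UNIV) f")
  case True
  hence "Infinite_Set_Sum.abs_summable_on f UNIV"
    by (simp add: Infinite_Set_Sum.abs_summable_on_def)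
  from infsetsum_infsum[OF this] show ?thesis
    by (simp add: infsetsum_def)
next
  case False
  hence "\<not> f summable_on UNIV"
    using trans[OF summable_on_iff_abs_summable_on_real abs_summable_equivalent, of f UNIV]
    unfolding Infinite_Set_Sum.abs_summable_on_def by blast
  thus ?thesis
    using False by (simp add: infsum_not_exists not_integrable_integral_eq)
qed

lemma (in prob_space) prob_eq_integral_fibres:
  fixes V :: "'a \<Rightarrow> 'b::countable"
  assumes V: "V \<in> measurable M (count_space UNIV)" and A: "A \<in> events"
  shows "integrable (count_space UNIV) (\<lambda>v. prob {\<omega> \<in> A. V \<omega> = v})"
    and "prob A = (\<integral>v. prob {\<omega> \<in> A. V \<omega> = v} \<partial>count_space UNIV)"
proof -
  have ev: "{\<omega> \<in> A. V \<omega> = v} \<in> events" for v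
  proof -
    have "{\<omega> \<in> A. V \<omega> = v} = A \<inter> (V -` {v} \<inter> space M)"
      using sets.sets_into_space[OF A] by auto
    thus ?thesis using A measurable_sets[OF V, of "{v}"] by auto
  qed
  have "A = (\<Union>v\<in>UNIV. {\<omega> \<in> A. V \<omega> = v})" by auto
  hence "emeasure M A = emeasure M (\<Union>v\<in>UNIV. {\<omega> \<in> A. V \<omega> = v})" by simp
  also have "\<dots> = (\<integral>\<^sup>+v. emeasure M {\<omega> \<in> A. V \<omega> = v} \<partial>count_space UNIV)"
    by (rule emeasure_UN_countable) (use ev in \<open>auto simp: disjoint_family_on_def\<close>)
  finally have eq: "(\<integral>\<^sup>+v. ennreal (prob {\<omega> \<in> A. V \<omega> = v}) \<partial>count_space UNIV) = ennreal (prob A)"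
    by (simp add: emeasure_eq_measure)
  show "integrable (count_space UNIV) (\<lambda>v. prob {\<omega> \<in> A. V \<omega> = v})"
    using eq by (intro integrableI_nonneg) auto
  show "prob A = (\<integral>v. prob {\<omega> \<in> A. V \<omega> = v} \<partial>count_space UNIV)"
    using eq by (subst integral_eq_nn_integral) auto
qed

lemma indep_rvD:
  assumes "prob_space M" "indep_rv M N V N' W" "A \<in> sets N" "B \<in> sets N'"
  shows "measure M {\<omega> \<in> space M. V \<omega> \<in> A \<and> W \<omega> \<in> B} =
    measure M {\<omega> \<in> space M. V \<omega> \<in> A} * measure M {\<omega> \<in> space M. W \<omega> \<in> B}"
proof -
  interpret prob_space M by fact
  have "prob ((V -` A \<inter> space M) \<inter> (W -` B \<inter> space M)) = prob (V -` A \<inter> space M) * prob (W -` B \<inter> space M)"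
    using assms by (intro indep_setD[of "sets (vimage_algebra (space M) V N)" "sets (vimage_algebra (space M) W N')"]
        in_vimage_algebra) (auto simp: indep_rv_def)
  moreover have "(V -` A \<inter> space M) \<inter> (W -` B \<inter> space M) = {\<omega> \<in> space M. V \<omega> \<in> A \<and> W \<omega> \<in> B}"
    "V -` A \<inter> space M = {\<omega> \<in> space M. V \<omega> \<in> A}" "W -` B \<inter> space M = {\<omega> \<in> space M. W \<omega> \<in> B}"
    by auto
  ultimately show ?thesis by simp
qed

section \<open>Mass functions of the operator and joint law of the counting sums\<close>

lemma pmf_diamond_pmf:
  "pmf (diamond_pmf a x) k = measure_pmf.prob (Pi_pmf {..x} 0 (\<lambda>_. counting_pmf a)) {g. (\<Sum>j\<le>x. g j) = k}"
  unfolding diamond_pmf_def pmf_map by (rule arg_cong[where f = "measure_pmf.prob _"]) auto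

text \<open>Summands of a sum equal to \<open>k\<close> are at most \<open>k\<close>, so finitely
  many configurations matter. As a finite sum of products, the mass function inherits measurability
  in \<open>a\<close> from \<open>counting_pmf\<close>.\<close>

lemma pmf_diamond_pmf_sum:
  "pmf (diamond_pmf a x) k =
     (\<Sum>g | g \<in> PiE_dflt {..x} 0 (\<lambda>_. {..k}) \<and> (\<Sum>j\<le>x. g j) = k. \<Prod>j\<le>x. pmf (counting_pmf a) (g j))"
proof -
  let ?P = "Pi_pmf {..x} 0 (\<lambda>_. counting_pmf a)"
  let ?S = "{g. g \<in> PiE_dflt {..x} 0 (\<lambda>_. {..k}) \<and> (\<Sum>j\<le>x. g j) = k}"
  have fin: "finite ?S"
    by (rule finite_subset[OF _ finite_PiE_dflt[of "{..x}" "\<lambda>_. {..k}" 0]]) auto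
  have "pmf (diamond_pmf a x) k = measure_pmf.prob ?P ?S"
    unfolding pmf_diamond_pmf
  proof (rule measure_prob_cong_0)
    \<comment> \<open>A configuration with the right sum that is left out of the finite set must be
      nonzero outside \<open>{..x}\<close>, where the product law puts the default value 0.\<close>
    fix g assume g: "g \<in> {g. (\<Sum>j\<le>x. g j) = k} - ?S"
    hence k: "(\<Sum>j\<le>x. g j) = k" by simp
    hence "g j \<le> k" if "j \<le> x" for j
      using member_le_sum[of j "{..x}" g] that by auto
    hence "\<not> (\<forall>j. j \<notin> {..x} \<longrightarrow> g j = 0)"
      using g k by (auto simp: PiE_dflt_def)
    thus "pmf ?P g = 0" by (intro pmf_Pi_outside) auto
  qed auto
  also have "\<dots> = (\<Sum>g\<in>?S. pmf ?P g)"
    by (rule measure_measure_pmf_finite[OF fin])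
  also have "\<dots> = (\<Sum>g\<in>?S. \<Prod>j\<le>x. pmf (counting_pmf a) (g j))"
    by (intro sum.cong refl pmf_Pi') (auto simp: PiE_dflt_def)
  finally show ?thesis .
qed

lemma pmf_counting_pmf: "0 < a \<Longrightarrow> pmf (counting_pmf a) k = (a / (1 + a)) ^ k * (1 / (1 + a))"
proof -
  assume a: "0 < a"
  hence "1 - 1 / (1 + a) = a / (1 + a)" by (simp add: field_simps)
  thus ?thesis using a by (simp add: counting_pmf_def)
qed

lemma borel_measurable_beta_prime_iff: "f \<in> borel_measurable (beta_prime c d) \<longleftrightarrow> f \<in> borel_measurable borel"
  by (simp add: beta_prime_def)

lemma diamond_prob_nonneg: "0 \<le> diamond_prob c d x k"
  unfolding diamond_prob_def by simp

lemma AE_beta_prime_pos: "AE a in beta_prime c d. 0 < a"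
  unfolding beta_prime_def by (subst AE_density) (auto simp: indicator_def)

lemma finite_states_le: "finite {z :: state. \<forall>i. z $ i \<le> y $ i}"
proof (rule finite_subset)
  show "{z :: state. \<forall>i. z $ i \<le> y $ i} \<subseteq> vec_lambda ` (PiE UNIV (\<lambda>i. {..y $ i}))"
  proof
    fix z :: state assume "z \<in> {z. \<forall>i. z $ i \<le> y $ i}"
    hence "vec_nth z \<in> PiE UNIV (\<lambda>i. {..y $ i})" by auto
    thus "z \<in> vec_lambda ` (PiE UNIV (\<lambda>i. {..y $ i}))"
      by (metis image_eqI vec_nth_inverse)
  qed
  show "finite (vec_lambda ` (PiE UNIV (\<lambda>i::2. {..y $ i})))"
    by (intro finite_imageI finite_PiE) auto
qed

context brcmnbinar
begin

text \<open>With trivial events and \<open>r = 0\<close>, \<open>coef_counting\<close> says that the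
  two total masses multiply to 1. Being nonzero also rules out infinite mass, because
  \<open>measure\<close> is 0 there; finiteness below rests on this.\<close>

lemma measure_beta_prime_nonzero: "measure (beta_prime (m i) l) UNIV \<noteq> 0"
proof -
  have "(\<Prod>i\<in>UNIV. LINT a:UNIV|beta_prime (m i) l. (1::real)) = prob (space M)"
    using coef_counting[of 2 "\<lambda>_. UNIV" 0] by simp
  hence "(\<Prod>i\<in>UNIV. measure (beta_prime (m i) l) UNIV) \<noteq> 0"
    by (simp add: prob_space set_lebesgue_integral_def beta_prime_def)
  thus ?thesis by (simp add: prod_zero_iff)
qed

lemma finite_measure_beta_prime: "finite_measure (beta_prime (m i) l)"
proof
  have "emeasure (beta_prime (m i) l) UNIV \<noteq> \<infinity>"
    using measure_beta_prime_nonzero[of i] by (auto simp: measure_def)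
  thus "emeasure (beta_prime (m i) l) (space (beta_prime (m i) l)) \<noteq> \<infinity>"
    by (simp add: beta_prime_def)
qed

text \<open>On \<open>{0<..}\<close> the mass function has its explicit formula, hence is measurable
  there and strictly positive; the half line carries all of a nonzero measure.\<close>

lemma integral_pmf_counting_pos:
  "0 < (LINT a:{0<..}|beta_prime (m i) l. pmf (counting_pmf a) k)"
proof -
  let ?N = "beta_prime (m i) l"
  let ?f = "\<lambda>a. indicator {0<..} a *\<^sub>R pmf (counting_pmf a) k"
  interpret N: finite_measure ?N by (rule finite_measure_beta_prime)
  have eq: "?f = (\<lambda>a. indicator {0<..} a * ((a / (1 + a)) ^ k * (1 / (1 + a))))"
    by (auto simp: fun_eq_iff indicator_def pmf_counting_pmf)
  have "(\<lambda>a::real. indicator {0<..} a * ((a / (1 + a)) ^ k * (1 / (1 + a)))) \<in> borel_measurable ?N"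
    unfolding beta_prime_def by measurable
  hence meas: "?f \<in> borel_measurable ?N"
    by (rule ssubst[OF eq])
  have int: "integrable ?N ?f"
    by (rule N.integrable_const_bound[where B = 1, OF _ meas]) (auto simp: indicator_def pmf_le_1)
  have "integral\<^sup>L ?N ?f \<noteq> 0"
  proof
    assume "integral\<^sup>L ?N ?f = 0"
    hence "AE a in ?N. ?f a = 0"
      using int by (subst (asm) integral_nonneg_eq_0_iff_AE) auto
    hence "AE a in ?N. False"
      using AE_beta_prime_pos
    proof eventually_elim
      case (elim a)
      thus ?case by (auto simp: indicator_def pmf_counting_pmf)
    qed
    hence "emeasure ?N (space ?N) = 0"
      by (simp add: AE_iff_null null_sets_def)
    hence "measure ?N UNIV = 0"
      by (simp add: measure_def beta_prime_def)
    thus False using measure_beta_prime_nonzero by simp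
  qed
  moreover have "0 \<le> integral\<^sup>L ?N ?f" by (intro Bochner_Integration.integral_nonneg) auto
  ultimately show ?thesis unfolding set_lebesgue_integral_def by linarith
qed

text \<open>For negative \<open>a\<close> the value \<open>counting_pmf a\<close> is unspecified, so measurability of its mass
  function is not a theorem. It follows from the joint law of coefficients and counting variables:
  a non-measurable integrand would have integral 0, contradicting the positive probability of the
  event.\<close>

lemma borel_measurable_pmf_counting [measurable]: "(\<lambda>a. pmf (counting_pmf a) k) \<in> borel_measurable borel"
proof -
  have "0 < (\<Prod>i\<in>UNIV. LINT a:{0<..}|beta_prime (m i) l. pmf (counting_pmf a) k)"
    by (intro prod_pos ballI integral_pmf_counting_pos)
  also have "\<dots> = prob {\<omega> \<in> space M. \<forall>i. \<alpha> i 2 \<omega> \<in> {0<..} \<and> (\<forall>j<1. G i 2 j \<omega> = k)}"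
    using coef_counting[of 2 "\<lambda>_. {0<..}" 1 "\<lambda>_ _. k"] by simp
  \<comment> \<open>Enlarging the event carries positivity over to the integral on the whole line,
    whose integrand is the mass function itself without cut-off.\<close>
  also have "\<dots> \<le> prob {\<omega> \<in> space M. \<forall>i. \<alpha> i 2 \<omega> \<in> UNIV \<and> (\<forall>j<1. G i 2 j \<omega> = k)}"
  proof (rule finite_measure_mono)
    note [measurable] = meas_G[OF order_refl]
    show "{\<omega> \<in> space M. \<forall>i. \<alpha> i 2 \<omega> \<in> UNIV \<and> (\<forall>j<1. G i 2 j \<omega> = k)} \<in> events"
      by simp
  qed auto
  also have "\<dots> = (\<Prod>i\<in>UNIV. LINT a:UNIV|beta_prime (m i) l. pmf (counting_pmf a) k)"
    using coef_counting[of 2 "\<lambda>_. UNIV" 1 "\<lambda>_ _. k"] by simp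
  finally have "(LINT a:UNIV|beta_prime (m 1) l. pmf (counting_pmf a) k) \<noteq> 0"
    by (metis UNIV_I finite less_irrefl prod_zero)
  hence "integrable (beta_prime (m 1) l) (\<lambda>a. pmf (counting_pmf a) k)"
    using not_integrable_integral_eq by (fastforce simp: set_lebesgue_integral_def)
  hence "(\<lambda>a. pmf (counting_pmf a) k) \<in> borel_measurable (beta_prime (m 1) l)"
    by (rule borel_measurable_integrable)
  thus ?thesis
    by (simp add: beta_prime_def)
qed

lemma borel_measurable_pmf_diamond [measurable]: "(\<lambda>a. pmf (diamond_pmf a x) k) \<in> borel_measurable borel"
  unfolding pmf_diamond_pmf_sum by measurable

lemma nn_integral_pmf_diamond:
  "(\<integral>\<^sup>+a. ennreal (pmf (diamond_pmf a x) k) \<partial>beta_prime (m i) l) = ennreal (diamond_prob (m i) l x k)"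
proof -
  interpret N: finite_measure "beta_prime (m i) l" by (rule finite_measure_beta_prime)
  show ?thesis
    unfolding diamond_prob_def
    by (intro nn_integral_eq_integral N.integrable_const_bound[where B = 1])
       (auto simp: pmf_le_1 borel_measurable_beta_prime_iff)
qed

text \<open>\<open>coef_counting\<close> fixes the first \<open>r\<close> counting variables
  exactly, so the law of a partial sum is obtained by summing over all such paths. Tonelli moves
  this sum inside the integral over \<open>a\<close>, where it is a probability under the product
  law. Paths are extended by 0 from \<open>r\<close> on, which makes them outcomes of
  \<open>Pi_pmf\<close>.\<close>

lemma sum_paths_eq_diamond:
  fixes x r k :: nat
  assumes "x < r"
  defines "S \<equiv> {g. (\<forall>j\<ge>r. g j = 0) \<and> (\<Sum>j\<le>x. g j) = k}"
  shows "(\<integral>\<^sup>+g. ennreal (LINT a:UNIV|beta_prime (m i) l. (\<Prod>j<r. pmf (counting_pmf a) (g j))) \<partial>count_space S)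
    = ennreal (diamond_prob (m i) l x k)"
    and "countable S"
proof -
  interpret N: finite_measure "beta_prime (m i) l" by (rule finite_measure_beta_prime)
  let ?P = "\<lambda>a. Pi_pmf {..<r} 0 (\<lambda>_. counting_pmf a)"
  \<comment> \<open>A path that vanishes from \<open>r\<close> on is coded by a finite list, hence
    countability.\<close>
  have "S \<subseteq> range (\<lambda>u j. if j < length u then u ! j else (0::nat))"
  proof
    fix g assume "g \<in> S"
    hence "g = (\<lambda>u j. if j < length u then u ! j else 0) (map g [0..<r])"
      by (auto simp: S_def fun_eq_iff)
    thus "g \<in> range (\<lambda>u j. if j < length u then u ! j else (0::nat))" by blast
  qed
  thus cS: "countable S"
    by (rule countable_subset) auto
  have meas: "(\<lambda>a. \<Prod>j<r. pmf (counting_pmf a) (g j)) \<in> borel_measurable (beta_prime (m i) l)" for g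
    unfolding borel_measurable_beta_prime_iff by measurable
  have pmf_P: "pmf (?P a) g = (\<Prod>j<r. pmf (counting_pmf a) (g j))" if "g \<in> S" for a g
    using that by (intro pmf_Pi') (auto simp: S_def)
  have "(\<integral>\<^sup>+g. ennreal (LINT a:UNIV|beta_prime (m i) l. (\<Prod>j<r. pmf (counting_pmf a) (g j))) \<partial>count_space S)
      = (\<integral>\<^sup>+g. (\<integral>\<^sup>+a. ennreal (pmf (?P a) g) \<partial>beta_prime (m i) l) \<partial>count_space S)"
  proof (rule nn_integral_cong)
    fix g assume "g \<in> space (count_space S)"
    hence g: "g \<in> S" by simp
    have "integrable (beta_prime (m i) l) (\<lambda>a. \<Prod>j<r. pmf (counting_pmf a) (g j))"
      by (rule N.integrable_const_bound[where B = 1, OF _ meas])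
         (auto simp: abs_prod intro!: prod_le_1 pmf_le_1)
    thus "ennreal (LINT a:UNIV|beta_prime (m i) l. (\<Prod>j<r. pmf (counting_pmf a) (g j)))
        = (\<integral>\<^sup>+a. ennreal (pmf (?P a) g) \<partial>beta_prime (m i) l)"
      using g by (simp add: pmf_P set_lebesgue_integral_def nn_integral_eq_integral prod_nonneg)
  qed
  also have "\<dots> = (\<integral>\<^sup>+a. (\<integral>\<^sup>+g. ennreal (pmf (?P a) g) \<partial>count_space S) \<partial>beta_prime (m i) l)"
  proof (rule nn_integral_count_space_nn_integral[OF cS, symmetric])
    show "(\<lambda>a. ennreal (pmf (?P a) g)) \<in> borel_measurable (beta_prime (m i) l)" if "g \<in> S" for g
      using meas by (simp add: pmf_P[OF that])
  qed
  also have "\<dots> = (\<integral>\<^sup>+a. ennreal (pmf (diamond_pmf a x) k) \<partial>beta_prime (m i) l)"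
  proof (rule nn_integral_cong)
    fix a
    have "(\<integral>\<^sup>+g. ennreal (pmf (?P a) g) \<partial>count_space S) = emeasure (?P a) S"
      by (rule nn_integral_pmf)
    also have "\<dots> = ennreal (measure_pmf.prob (?P a) S)"
      by (rule measure_pmf.emeasure_eq_measure)
    also have "measure_pmf.prob (?P a) S = measure_pmf.prob (?P a) {g. (\<Sum>j\<le>x. g j) = k}"
      by (rule measure_prob_cong_0) (auto simp: S_def not_less intro!: pmf_Pi_outside)
    also have "\<dots> = pmf (diamond_pmf a x) k"
    proof -
      \<comment> \<open>The coordinates strictly between \<open>x\<close> and \<open>r\<close> do
        not enter the sum and are integrated out by marginalisation.\<close>
      have "Pi_pmf {..x} 0 (\<lambda>_. counting_pmf a) = map_pmf (\<lambda>f j. if j \<in> {..x} then f j else 0) (?P a)"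
        using assms(1) by (intro Pi_pmf_subset) auto
      thus ?thesis by (simp add: pmf_diamond_pmf vimage_def)
    qed
    finally show "(\<integral>\<^sup>+g. ennreal (pmf (?P a) g) \<partial>count_space S) = ennreal (pmf (diamond_pmf a x) k)" .
  qed
  also have "\<dots> = ennreal (diamond_prob (m i) l x k)"
    by (rule nn_integral_pmf_diamond)
  finally show "(\<integral>\<^sup>+g. ennreal (LINT a:UNIV|beta_prime (m i) l. (\<Prod>j<r. pmf (counting_pmf a) (g j))) \<partial>count_space S)
    = ennreal (diamond_prob (m i) l x k)" .
qed

text \<open>The event is a countable disjoint union of cylinders \<open>E p\<close>, one for each
  pair of paths. The probability of a cylinder is a product over the two components, so the double
  sum factorises.\<close>

lemma prob_counting_sums:
  fixes x u :: state
  assumes t: "2 \<le> t"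
  shows "prob {\<omega> \<in> space M. \<forall>i. (\<Sum>j\<le>x $ i. G i t j \<omega>) = u $ i} = (\<Prod>i\<in>UNIV. diamond_prob (m i) l (x $ i) (u $ i))"
proof -
  note [measurable] = meas_G[OF t]
  \<comment> \<open>\<open>coef_counting\<close> prescribes the same number of counting variables in
    both components, so \<open>r\<close> must exceed both upper summation indices.\<close>
  define r where "r = Suc (x $ 1 + x $ 2)"
  have r: "x $ 1 < r" "x $ 2 < r" by (auto simp: r_def)
  define S where "S i = {g. (\<forall>j\<ge>r. g j = 0) \<and> (\<Sum>j\<le>x $ i. g j) = u $ i}" for i :: 2
  define q where "q i g = ennreal (LINT a:UNIV|beta_prime (m i) l. (\<Prod>j<r. pmf (counting_pmf a) (g j)))" for i g
  have q: "(\<integral>\<^sup>+g. q i g \<partial>count_space (S i)) = ennreal (diamond_prob (m i) l (x $ i) (u $ i))"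
    and cS: "countable (S i)" for i
  proof -
    have "x $ i < r" using r exhaust_2[of i] by auto
    from sum_paths_eq_diamond[OF this, where k = "u $ i"]
    show "(\<integral>\<^sup>+g. q i g \<partial>count_space (S i)) = ennreal (diamond_prob (m i) l (x $ i) (u $ i))"
      and "countable (S i)"
      by (auto simp: q_def S_def)
  qed
  define E where "E p = {\<omega> \<in> space M. \<forall>i. \<forall>j<r. G i t j \<omega> = (if i = 1 then fst p else snd p) j}" for p
  have E_ev: "E p \<in> events" for p
    unfolding E_def by measurable
  have E_prob: "emeasure M (E p) = q 1 (fst p) * q 2 (snd p)" for p
  proof -
    have "prob (E p) = (\<Prod>i\<in>UNIV. LINT a:UNIV|beta_prime (m i) l.
        (\<Prod>j<r. pmf (counting_pmf a) ((if i = 1 then fst p else snd p) j)))"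
      using coef_counting[OF t, of "\<lambda>_. UNIV" r "\<lambda>i j. (if i = 1 then fst p else snd p) j"] by (simp add: E_def)
    thus ?thesis
      by (simp add: UNIV_2 emeasure_eq_measure q_def ennreal_mult set_lebesgue_integral_def
          Bochner_Integration.integral_nonneg prod_nonneg)
  qed
  have "{\<omega> \<in> space M. \<forall>i. (\<Sum>j\<le>x $ i. G i t j \<omega>) = u $ i} = (\<Union>p\<in>S 1 \<times> S 2. E p)"
  proof (intro equalityI subsetI)
    fix \<omega> assume "\<omega> \<in> {\<omega> \<in> space M. \<forall>i. (\<Sum>j\<le>x $ i. G i t j \<omega>) = u $ i}"
    hence \<omega>: "\<omega> \<in> space M" "\<And>i. (\<Sum>j\<le>x $ i. G i t j \<omega>) = u $ i" by auto
    define g where "g i = (\<lambda>j. if j < r then G i t j \<omega> else 0)" for i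
    have "(\<Sum>j\<le>x $ i. g i j) = (\<Sum>j\<le>x $ i. G i t j \<omega>)" for i
      using r exhaust_2[of i] by (intro sum.cong) (auto simp: g_def)
    hence "g i \<in> S i" for i
      using \<omega>(2)[of i] by (auto simp: S_def g_def)
    moreover have "\<omega> \<in> E (g 1, g 2)"
      using \<omega>(1) exhaust_2 by (auto simp: E_def g_def)
    ultimately show "\<omega> \<in> (\<Union>p\<in>S 1 \<times> S 2. E p)" by blast
  next
    fix \<omega> assume "\<omega> \<in> (\<Union>p\<in>S 1 \<times> S 2. E p)"
    then obtain g where g: "g 1 \<in> S 1" "g 2 \<in> S (2::2)" "\<omega> \<in> space M"
      "\<And>i j. j < r \<Longrightarrow> G i t j \<omega> = g i j"
    proof -
      assume *: "\<And>g. g 1 \<in> S 1 \<Longrightarrow> g 2 \<in> S (2::2) \<Longrightarrow> \<omega> \<in> space M \<Longrightarrow>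
        (\<And>i j. j < r \<Longrightarrow> G i t j \<omega> = g i j) \<Longrightarrow> thesis"
      assume "\<omega> \<in> (\<Union>p\<in>S 1 \<times> S 2. E p)"
      then obtain a b where "a \<in> S 1" "b \<in> S 2" "\<omega> \<in> E (a, b)" by auto
      thus thesis
        by (intro *[of "\<lambda>i. if i = 1 then a else b"]) (auto simp: E_def)
    qed
    have "(\<Sum>j\<le>x $ i. G i t j \<omega>) = (\<Sum>j\<le>x $ i. g i j)" for i
      using r exhaust_2[of i] by (intro sum.cong refl g(4)) auto
    hence "(\<Sum>j\<le>x $ i. G i t j \<omega>) = u $ i" for i
      using g exhaust_2[of i] by (auto simp: S_def)
    thus "\<omega> \<in> {\<omega> \<in> space M. \<forall>i. (\<Sum>j\<le>x $ i. G i t j \<omega>) = u $ i}"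
      using g(3) by auto
  qed
  hence "emeasure M {\<omega> \<in> space M. \<forall>i. (\<Sum>j\<le>x $ i. G i t j \<omega>) = u $ i} = emeasure M (\<Union>p\<in>S 1 \<times> S 2. E p)"
    by simp
  also have "\<dots> = (\<integral>\<^sup>+p. emeasure M (E p) \<partial>count_space (S 1 \<times> S 2))"
  proof (rule emeasure_UN_countable)
    show "disjoint_family_on E (S 1 \<times> S 2)"
      unfolding disjoint_family_on_def
    proof (intro ballI impI)
      fix p p' assume p: "p \<in> S 1 \<times> S 2" "p' \<in> S 1 \<times> S 2" "p \<noteq> p'"
      show "E p \<inter> E p' = {}"
      proof (rule ccontr)
        assume "E p \<inter> E p' \<noteq> {}"
        then obtain \<omega> where \<omega>: "\<omega> \<in> E p" "\<omega> \<in> E p'" by blast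
        have *: "(if i = 1 then fst p else snd p) j = (if i = 1 then fst p' else snd p') j" if "j < r" for i :: 2 and j
          using \<omega> that by (auto simp: E_def)
        \<comment> \<open>A common outcome makes the paths agree below \<open>r\<close>; from
          \<open>r\<close> on both are 0.\<close>
        have "fst p j = fst p' j" "snd p j = snd p' j" for j
          using p(1,2) *[of j 1] *[of j 2] by (cases "j < r"; auto simp: S_def)+
        hence "fst p = fst p'" "snd p = snd p'" by auto
        with p(3) show False by (simp add: prod_eq_iff)
      qed
    qed
  qed (use E_ev cS in auto)
  also have "\<dots> = (\<integral>\<^sup>+p. q 1 (fst p) * q 2 (snd p) \<partial>(count_space (S 1) \<Otimes>\<^sub>M count_space (S 2)))"
    by (simp add: E_prob pair_measure_countable cS)
  also have "\<dots> = (\<integral>\<^sup>+g. (\<integral>\<^sup>+h. q 1 g * q 2 h \<partial>count_space (S 2)) \<partial>count_space (S 1))"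
    by (subst sigma_finite_measure.nn_integral_fst[OF sigma_finite_measure_count_space_countable[OF cS], symmetric])
       (auto simp: pair_measure_countable cS)
  also have "\<dots> = ennreal (diamond_prob (m 1) l (x $ 1) (u $ 1)) * ennreal (diamond_prob (m 2) l (x $ 2) (u $ 2))"
    by (simp add: nn_integral_cmult nn_integral_multc q)
  finally show ?thesis
    by (simp add: emeasure_eq_measure UNIV_2 diamond_prob_nonneg flip: ennreal_mult)
qed

section \<open>One-step and h-step transitions of the process\<close>

lemma measurable_history:
  "2 \<le> t \<Longrightarrow> (\<lambda>\<omega>. map (\<lambda>s. X s \<omega>) [1..<t]) \<in> measurable M (count_space UNIV)"
  using triples_indep_past[of t] by (simp add: indep_rv_def)

text \<open>This is \<open>trans_prob\<close> at the true parameter, expressed through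
  \<open>m\<close> and \<open>f\<close> because the locale knows a single innovation law and no
  parametric family.\<close>

definition transition :: "state \<Rightarrow> state \<Rightarrow> real" where
  "transition w y = (\<Sum>z | \<forall>i. z $ i \<le> y $ i.
     pmf f z * (\<Prod>i\<in>UNIV. diamond_prob (m i) l (w $ i) (y $ i - z $ i)))"

text \<open>Two independence assumptions are used in turn. The first splits the innovation from the
  thinned vector and the past jointly. Then, since \<open>B\<close> fixes the present state as
  \<open>w\<close>, the thinned vector is on this event a function of the counting variables at time
  \<open>t\<close>, which are independent of the past.\<close>

lemma prob_history_step:
  assumes t: "2 \<le> t" and last: "\<And>\<omega>. \<omega> \<in> space M \<Longrightarrow> map (\<lambda>s. X s \<omega>) [1..<t] \<in> B \<Longrightarrow> X (t - 1) \<omega> = w"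
  shows "prob {\<omega> \<in> space M. map (\<lambda>s. X s \<omega>) [1..<t] \<in> B \<and> X t \<omega> = y} =
    prob {\<omega> \<in> space M. map (\<lambda>s. X s \<omega>) [1..<t] \<in> B} * transition w y"
proof -
  note [measurable] = meas_G[OF t] meas_Z[OF t] measurable_history[OF t]
  let ?H = "\<lambda>\<omega>. map (\<lambda>s. X s \<omega>) [1..<t]"
  let ?D = "\<lambda>\<omega>. (\<chi> i. \<Sum>j\<le>X (t - 1) \<omega> $ i. G i t j \<omega>) :: state"
  let ?I = "{z :: state. \<forall>i. z $ i \<le> y $ i}"
  \<comment> \<open>Innovations are nonnegative, so only the finitely many \<open>z\<close> below
    \<open>y\<close> occur; for these the truncated difference \<open>y - z\<close> is
    exact.\<close>
  define A where "A z = {\<omega> \<in> space M. Z t \<omega> \<in> {z} \<and> (?D \<omega>, ?H \<omega>) \<in> {y - z} \<times> B}" for z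
  have finI: "finite ?I"
    by (rule finite_states_le)
  have DH: "(\<lambda>\<omega>. (?D \<omega>, ?H \<omega>)) \<in> measurable M (count_space UNIV)"
    using innov_indep[OF t] by (simp add: indep_rv_def)
  have "{\<omega> \<in> space M. ?H \<omega> \<in> B \<and> X t \<omega> = y} = (\<Union>z\<in>?I. A z)"
  proof (intro equalityI subsetI)
    fix \<omega> assume "\<omega> \<in> {\<omega> \<in> space M. ?H \<omega> \<in> B \<and> X t \<omega> = y}"
    hence \<omega>: "\<omega> \<in> space M" "?H \<omega> \<in> B" "X t \<omega> = y" by auto
    have "y $ i = ?D \<omega> $ i + Z t \<omega> $ i" for i
      using recursion[OF t \<omega>(1), of i] \<omega>(3) by simp
    hence "Z t \<omega> \<in> ?I" "?D \<omega> = y - Z t \<omega>"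
      by (auto simp: vec_eq_iff)
    thus "\<omega> \<in> (\<Union>z\<in>?I. A z)"
      using \<omega> by (auto simp: A_def)
  next
    fix \<omega> assume "\<omega> \<in> (\<Union>z\<in>?I. A z)"
    then obtain z where z: "z \<in> ?I" "\<omega> \<in> space M" "Z t \<omega> = z" "?D \<omega> = y - z" "?H \<omega> \<in> B"
      by (auto simp: A_def)
    have "X t \<omega> $ i = y $ i" for i
    proof -
      have "X t \<omega> $ i = ?D \<omega> $ i + Z t \<omega> $ i"
        using recursion[OF t z(2), of i] by simp
      thus ?thesis using z(1) unfolding z(3,4) by simp
    qed
    thus "\<omega> \<in> {\<omega> \<in> space M. ?H \<omega> \<in> B \<and> X t \<omega> = y}"
      using z by (simp add: vec_eq_iff)
  qed
  hence "prob {\<omega> \<in> space M. ?H \<omega> \<in> B \<and> X t \<omega> = y} = prob (\<Union>z\<in>?I. A z)"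
    by simp
  also have "\<dots> = (\<Sum>z\<in>?I. prob (A z))"
  proof (rule finite_measure_finite_Union[OF finI])
    have "A z = (Z t -` {z} \<inter> space M) \<inter> ((\<lambda>\<omega>. (?D \<omega>, ?H \<omega>)) -` ({y - z} \<times> B) \<inter> space M)" for z
      by (auto simp: A_def)
    moreover have "Z t -` {z} \<inter> space M \<in> events" for z
      by (rule measurable_sets[OF meas_Z[OF t]]) simp
    moreover have "(\<lambda>\<omega>. (?D \<omega>, ?H \<omega>)) -` ({y - z} \<times> B) \<inter> space M \<in> events" for z
      by (rule measurable_sets[OF DH]) simp
    ultimately show "A ` ?I \<subseteq> events" by auto
    show "disjoint_family_on A ?I"
      by (auto simp: disjoint_family_on_def A_def)
  qed
  also have "\<dots> = (\<Sum>z\<in>?I. prob {\<omega> \<in> space M. ?H \<omega> \<in> B} *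
      (pmf f z * (\<Prod>i\<in>UNIV. diamond_prob (m i) l (w $ i) (y $ i - z $ i))))"
  proof (rule sum.cong[OF refl])
    fix z
    have "prob (A z) = prob {\<omega> \<in> space M. Z t \<omega> \<in> {z}} * prob {\<omega> \<in> space M. (?D \<omega>, ?H \<omega>) \<in> {y - z} \<times> B}"
      unfolding A_def by (rule indep_rvD[OF prob_space_axioms innov_indep[OF t]]) auto
    also have "prob {\<omega> \<in> space M. Z t \<omega> \<in> {z}} = measure (distr M (count_space UNIV) (Z t)) {z}"
      by (subst measure_distr) (auto intro!: arg_cong[where f = prob])
    also have "\<dots> = pmf f z"
      by (simp add: innov_distr[OF t] pmf.rep_eq)
    \<comment> \<open>On this event the random upper limit of the sums is the constant
      \<open>w\<close>.\<close>
    also have "prob {\<omega> \<in> space M. (?D \<omega>, ?H \<omega>) \<in> {y - z} \<times> B} =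
        prob {\<omega> \<in> space M. (\<lambda>i. \<alpha> i t \<omega>, \<lambda>(i, j). G i t j \<omega>, Z t \<omega>) \<in>
          {p \<in> space ((\<Pi>\<^sub>M i\<in>UNIV. borel) \<Otimes>\<^sub>M ((\<Pi>\<^sub>M ij\<in>UNIV. count_space UNIV) \<Otimes>\<^sub>M count_space UNIV)).
            \<forall>i. (\<Sum>j\<le>w $ i. fst (snd p) (i, j)) = (y - z) $ i} \<and> ?H \<omega> \<in> B}"
      (is "_ = prob {\<omega> \<in> space M. ?V \<omega> \<in> ?E \<and> _}")
      using last by (intro arg_cong[where f = prob] Collect_cong)
        (auto simp: vec_eq_iff space_pair_measure space_PiM)
    also have "\<dots> = prob {\<omega> \<in> space M. ?V \<omega> \<in> ?E} * prob {\<omega> \<in> space M. ?H \<omega> \<in> B}"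
      by (rule indep_rvD[OF prob_space_axioms triples_indep_past[OF t]]) auto
    also have "{\<omega> \<in> space M. ?V \<omega> \<in> ?E} = {\<omega> \<in> space M. \<forall>i. (\<Sum>j\<le>w $ i. G i t j \<omega>) = (y - z) $ i}"
      by (auto simp: space_pair_measure space_PiM)
    also have "prob \<dots> = (\<Prod>i\<in>UNIV. diamond_prob (m i) l (w $ i) ((y - z) $ i))"
      by (rule prob_counting_sums[OF t])
    finally show "prob (A z) = prob {\<omega> \<in> space M. ?H \<omega> \<in> B} *
      (pmf f z * (\<Prod>i\<in>UNIV. diamond_prob (m i) l (w $ i) (y $ i - z $ i)))"
      by (simp add: mult_ac)
  qed
  also have "\<dots> = prob {\<omega> \<in> space M. ?H \<omega> \<in> B} * transition w y"
    by (simp add: transition_def sum_distrib_left)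
  finally show ?thesis .
qed

text \<open>The event at time \<open>n\<close> is kept alongside the present state so that the
  induction on the horizon can condition on a fixed starting time.\<close>

lemma prob_two_times_step:
  assumes "1 \<le> n" "n \<le> s"
  shows "prob {\<omega> \<in> space M. X n \<omega> = x \<and> X s \<omega> = w \<and> X (Suc s) \<omega> = y} =
    prob {\<omega> \<in> space M. X n \<omega> = x \<and> X s \<omega> = w} * transition w y"
proof -
  \<comment> \<open>The history list starts with time 1, so time \<open>n\<close> is at position
    \<open>n - 1\<close>.\<close>
  let ?B = "{xs. xs ! (n - 1) = x \<and> xs ! (s - 1) = w}"
  have nth: "map (\<lambda>s. X s \<omega>) [1..<Suc s] ! (k - 1) = X k \<omega>" if "1 \<le> k" "k \<le> s" for k \<omega>
    using that by (subst nth_map) (auto simp del: upt_Suc)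
  have "prob {\<omega> \<in> space M. map (\<lambda>s. X s \<omega>) [1..<Suc s] \<in> ?B \<and> X (Suc s) \<omega> = y} =
    prob {\<omega> \<in> space M. map (\<lambda>s. X s \<omega>) [1..<Suc s] \<in> ?B} * transition w y"
    using assms nth[of s] by (intro prob_history_step) (auto simp del: upt_Suc)
  thus ?thesis
    using assms by (simp add: nth conj_assoc del: upt_Suc)
qed

end

text \<open>Chapman-Kolmogorov, by splitting according to the state at time \<open>n + h\<close>.
  The product form stays valid when the starting event is null, so no division enters the
  induction.\<close>

lemma (in brcmnbinar) prob_hstep:
  assumes T: "\<And>w y. trans_prob l F \<tau> w y = transition w y" and n: "1 \<le> n"
  shows "prob {\<omega> \<in> space M. X n \<omega> = x \<and> X (n + h) \<omega> = y} =
    prob {\<omega> \<in> space M. X n \<omega> = x} * hstep_prob l F h \<tau> x y"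
proof (induction h arbitrary: y)
  case 0
  have "prob {\<omega> \<in> space M. X n \<omega> = x \<and> X n \<omega> = y} = (if x = y then prob {\<omega> \<in> space M. X n \<omega> = x} else 0)"
  proof (cases "x = y")
    case False
    hence "{\<omega> \<in> space M. X n \<omega> = x \<and> X n \<omega> = y} = {}" by auto
    thus ?thesis using False by (simp only: measure_empty if_False)
  qed (simp add: conj_commute)
  thus ?case by simp
next
  case (Suc h)
  note [measurable] = meas_X
  let ?A = "{\<omega> \<in> space M. X n \<omega> = x \<and> X (n + Suc h) \<omega> = y}"
  have "?A = (X n -` {x} \<inter> space M) \<inter> (X (n + Suc h) -` {y} \<inter> space M)" by auto
  also have "\<dots> \<in> events"
    using n by (intro sets.Int measurable_sets[OF meas_X]) auto
  finally have "prob ?A = (\<integral>w. prob {\<omega> \<in> ?A. X (n + h) \<omega> = w} \<partial>count_space UNIV)"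
    using n by (intro prob_eq_integral_fibres meas_X) auto
  also have "\<dots> = (\<integral>w. prob {\<omega> \<in> space M. X n \<omega> = x} * (hstep_prob l F h \<tau> x w * trans_prob l F \<tau> w y) \<partial>count_space UNIV)"
  proof (rule Bochner_Integration.integral_cong[OF refl])
    fix w
    have "{\<omega> \<in> ?A. X (n + h) \<omega> = w} = {\<omega> \<in> space M. X n \<omega> = x \<and> X (n + h) \<omega> = w \<and> X (Suc (n + h)) \<omega> = y}"
      by auto
    thus "prob {\<omega> \<in> ?A. X (n + h) \<omega> = w} =
      prob {\<omega> \<in> space M. X n \<omega> = x} * (hstep_prob l F h \<tau> x w * trans_prob l F \<tau> w y)"
      using n by (simp add: prob_two_times_step Suc.IH T)
  qed
  also have "\<dots> = prob {\<omega> \<in> space M. X n \<omega> = x} * hstep_prob l F (Suc h) \<tau> x y"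
    by (simp add: infsum_eq_integral_count_space)
  finally show ?case .
qed

subsection \<open>The delta method and the confidence interval\<close>

lemma real_distribution_normal_law: "0 \<le> v \<Longrightarrow> real_distribution (normal_law \<mu> v)"
  by (simp add: normal_law_def real_distribution_def real_distribution_axioms_def
      prob_space_return prob_space_normal_density)

text \<open>A continuous substitute for the indicator of norm at least \<open>K\<close>: it is 0 up
  to norm \<open>K / 2\<close> and 1 from \<open>K\<close> on. Weak convergence tests only
  continuous functions.\<close>

definition norm_ramp :: "real \<Rightarrow> 'b::real_normed_vector \<Rightarrow> real" where
  "norm_ramp K y = min 1 (max 0 (2 * norm y / K - 1))"

lemma norm_ramp_bounds: "0 \<le> norm_ramp K y" "norm_ramp K y \<le> 1"
  by (auto simp: norm_ramp_def)

lemma abs_norm_ramp_le: "\<bar>norm_ramp K y\<bar> \<le> 1"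
  by (auto simp: norm_ramp_def)

lemma norm_ramp_eq_1: "0 < K \<Longrightarrow> K \<le> norm y \<Longrightarrow> norm_ramp K y = 1"
  by (simp add: norm_ramp_def le_divide_eq)

lemma continuous_on_norm_ramp: "0 < K \<Longrightarrow> continuous_on UNIV (norm_ramp K)"
  unfolding norm_ramp_def by (intro continuous_intros) auto

lemma borel_measurable_norm_ramp [measurable]: "norm_ramp K \<in> borel_measurable borel"
  unfolding norm_ramp_def by measurable

text \<open>Tightness of the limit law: at a given \<open>y\<close> the ramp is 0 as soon as its
  level exceeds twice the norm of \<open>y\<close>, and the ramps are bounded by 1.\<close>

lemma integral_norm_ramp_tendsto_0:
  fixes \<nu> :: "'b::{real_normed_vector, second_countable_topology} measure"
  assumes "prob_space \<nu>" "sets \<nu> = sets borel"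
  shows "(\<lambda>k. \<integral>y. norm_ramp (real (Suc k)) y \<partial>\<nu>) \<longlonglongrightarrow> 0"
proof -
  interpret prob_space \<nu> by fact
  note [measurable_cong] = assms(2)
  have "(\<lambda>k. \<integral>y. norm_ramp (real (Suc k)) y \<partial>\<nu>) \<longlonglongrightarrow> (\<integral>y. 0 \<partial>\<nu>)"
  proof (rule integral_dominated_convergence[where w = "\<lambda>_. 1"])
    show "AE y in \<nu>. (\<lambda>k. norm_ramp (real (Suc k)) y) \<longlonglongrightarrow> 0"
    proof (rule AE_I2)
      fix y :: 'b
      have "\<forall>\<^sub>F k in sequentially. norm_ramp (real (Suc k)) y = 0"
        using eventually_ge_at_top[of "nat \<lceil>2 * norm y\<rceil>"]
        by eventually_elim (auto simp: norm_ramp_def divide_le_eq)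
      thus "(\<lambda>k. norm_ramp (real (Suc k)) y) \<longlonglongrightarrow> 0"
        by (simp add: tendsto_eventually)
    qed
  qed (auto simp: abs_norm_ramp_le)
  thus ?thesis by simp
qed

lemma norm_iexp_diff_le: "norm (iexp a - iexp b) \<le> \<bar>a - b\<bar>"
proof -
  have "iexp a = iexp b * iexp (a - b)"
    unfolding exp_add[symmetric] by (simp add: algebra_simps)
  hence "iexp a - iexp b = iexp b * (iexp (a - b) - 1)"
    by (simp only: right_diff_distrib mult_1_right)
  hence "norm (iexp a - iexp b) = norm (iexp (a - b) - 1)"
    by (simp add: norm_mult)
  also have "\<dots> \<le> \<bar>a - b\<bar>"
    using iexp_approx1[of "a - b" 0] by simp
  finally show ?thesis .
qed

text \<open>By Levy's continuity theorem it suffices to compare characteristic functions: those of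
  \<open>r n * (p (T n) - p \<tau>)\<close> and of the linearization \<open>D \<bullet> (r n *\<^sub>R (T n - \<tau>))\<close> differ by at most
  the expectation of \<open>min 2 (\<bar>t\<bar> * \<bar>remainder\<bar>)\<close>, and tightness controls the remainder.\<close>

lemma delta_method:
  fixes T :: "nat \<Rightarrow> 'a \<Rightarrow> real ^ 'k::finite" and p :: "real ^ 'k \<Rightarrow> real" and r :: "nat \<Rightarrow> real"
  assumes M: "prob_space M"
    and [measurable]: "\<And>n. T n \<in> borel_measurable M" "\<And>n. (\<lambda>\<omega>. p (T n \<omega>)) \<in> borel_measurable M"
    and \<nu>: "prob_space \<nu>" "sets \<nu> = sets borel"
    and conv: "weak_conv_vec (\<lambda>n. distr M borel (\<lambda>\<omega>. r n *\<^sub>R (T n \<omega> - \<tau>))) \<nu>"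
    and r: "filterlim r at_top sequentially"
    and der: "(p has_derivative (\<lambda>v. D \<bullet> v)) (at \<tau>)"
  shows "weak_conv_m (\<lambda>n. distr M borel (\<lambda>\<omega>. r n * (p (T n \<omega>) - p \<tau>))) (distr \<nu> borel (\<lambda>x. D \<bullet> x))"
proof (rule levy_continuity)
  interpret M: prob_space M by fact
  interpret \<nu>: prob_space \<nu> by fact
  note [measurable_cong] = \<nu>(2)
  let ?Y = "\<lambda>n \<omega>. r n *\<^sub>R (T n \<omega> - \<tau>)"
  let ?W = "\<lambda>n \<omega>. r n * (p (T n \<omega>) - p \<tau>)"
  show "real_distribution (distr M borel (?W n))" for n
    by (intro M.real_distribution_distr) measurable
  show "real_distribution (distr \<nu> borel (\<lambda>x. D \<bullet> x))"
    by (intro \<nu>.real_distribution_distr) measurable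
  fix t :: real
  have Eg: "(\<lambda>n. \<integral>\<omega>. g (?Y n \<omega>) \<partial>M) \<longlonglongrightarrow> (\<integral>y. g y \<partial>\<nu>)"
    if "continuous_on UNIV g" "bounded (range g)" for g :: "real ^ 'k \<Rightarrow> real"
  proof -
    have [measurable]: "g \<in> borel_measurable borel"
      using that(1) by (rule borel_measurable_continuous_onI)
    have "(\<lambda>n. \<integral>y. g y \<partial>distr M borel (?Y n)) \<longlonglongrightarrow> (\<integral>y. g y \<partial>\<nu>)"
      using conv that unfolding weak_conv_vec_def by blast
    thus ?thesis by (simp add: integral_distr)
  qed
  have cint: "integrable M (\<lambda>\<omega>. iexp (t * f \<omega>))" if [measurable]: "f \<in> borel_measurable M" for f
    by (rule M.integrable_const_bound[where B = 1]) auto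
  have cint': "integrable \<nu> (\<lambda>y. iexp (t * (D \<bullet> y)))"
    by (rule \<nu>.integrable_const_bound[where B = 1]) auto
  \<comment> \<open>\<open>weak_conv_vec\<close> speaks of real test functions, so cosine and sine
    are treated separately and reassembled.\<close>
  have lin: "(\<lambda>n. \<integral>\<omega>. iexp (t * (D \<bullet> ?Y n \<omega>)) \<partial>M) \<longlonglongrightarrow> (\<integral>y. iexp (t * (D \<bullet> y)) \<partial>\<nu>)"
  proof -
    have "(\<lambda>n. \<integral>\<omega>. cos (t * (D \<bullet> ?Y n \<omega>)) \<partial>M) \<longlonglongrightarrow> (\<integral>y. cos (t * (D \<bullet> y)) \<partial>\<nu>)"
      "(\<lambda>n. \<integral>\<omega>. sin (t * (D \<bullet> ?Y n \<omega>)) \<partial>M) \<longlonglongrightarrow> (\<integral>y. sin (t * (D \<bullet> y)) \<partial>\<nu>)"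
      by (intro Eg continuous_intros boundedI[where B = 1]; force)+
    hence "(\<lambda>n. Complex (\<integral>\<omega>. cos (t * (D \<bullet> ?Y n \<omega>)) \<partial>M) (\<integral>\<omega>. sin (t * (D \<bullet> ?Y n \<omega>)) \<partial>M))
      \<longlonglongrightarrow> Complex (\<integral>y. cos (t * (D \<bullet> y)) \<partial>\<nu>) (\<integral>y. sin (t * (D \<bullet> y)) \<partial>\<nu>)"
      by (rule tendsto_Complex)
    moreover have "Complex (\<integral>\<omega>. cos (t * (D \<bullet> ?Y n \<omega>)) \<partial>M) (\<integral>\<omega>. sin (t * (D \<bullet> ?Y n \<omega>)) \<partial>M)
        = (\<integral>\<omega>. iexp (t * (D \<bullet> ?Y n \<omega>)) \<partial>M)" for n
      using integral_Re[OF cint[of "\<lambda>\<omega>. D \<bullet> ?Y n \<omega>"]] integral_Im[OF cint[of "\<lambda>\<omega>. D \<bullet> ?Y n \<omega>"]]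
      by (simp add: complex_eq_iff Re_exp Im_exp)
    moreover have "Complex (\<integral>y. cos (t * (D \<bullet> y)) \<partial>\<nu>) (\<integral>y. sin (t * (D \<bullet> y)) \<partial>\<nu>)
        = (\<integral>y. iexp (t * (D \<bullet> y)) \<partial>\<nu>)"
      using integral_Re[OF cint'] integral_Im[OF cint']
      by (simp add: complex_eq_iff Re_exp Im_exp)
    ultimately show ?thesis by simp
  qed
  have diff: "(\<lambda>n. (\<integral>\<omega>. iexp (t * ?W n \<omega>) \<partial>M) - (\<integral>\<omega>. iexp (t * (D \<bullet> ?Y n \<omega>)) \<partial>M)) \<longlonglongrightarrow> 0"
  proof (rule LIMSEQ_I)
    fix e :: real assume e: "0 < e"
    \<comment> \<open>The tail enters with factor 2, the largest distance of two points on the unit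
      circle, so \<open>e / 8\<close> costs \<open>e / 4\<close>; the linearization error costs
      another \<open>e / 4\<close>.\<close>
    obtain k where k: "(\<integral>y. norm_ramp (real (Suc k)) y \<partial>\<nu>) < e / 8"
    proof -
      have "\<forall>\<^sub>F k in sequentially. (\<integral>y. norm_ramp (real (Suc k)) y \<partial>\<nu>) < e / 8"
        using order_tendstoD(2)[OF integral_norm_ramp_tendsto_0[OF \<nu>], of "e / 8"] e by simp
      thus ?thesis using that by (auto simp: eventually_sequentially)
    qed
    define K where "K = real (Suc k)"
    have K: "0 < K" by (simp add: K_def)
    \<comment> \<open>Chosen so that an error of at most \<open>c * K\<close> in the exponent costs
      no more than \<open>e / 4\<close> after multiplication by t; the \<open>+ 1\<close> covers t =
      0.\<close>
    define c where "c = e / (4 * (\<bar>t\<bar> + 1) * K)"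
    have c: "0 < c" using e K by (simp add: c_def)
    have tcK: "\<bar>t\<bar> * (c * K) \<le> e / 4"
    proof -
      have "\<bar>t\<bar> * (c * K) = (\<bar>t\<bar> / (\<bar>t\<bar> + 1)) * (e / 4)"
        using K by (simp add: c_def)
      also have "\<dots> \<le> 1 * (e / 4)"
        using e by (intro mult_right_mono) auto
      finally show ?thesis by simp
    qed
    obtain d where d: "0 < d" "\<And>y. norm (y - \<tau>) < d \<Longrightarrow> \<bar>p y - p \<tau> - D \<bullet> (y - \<tau>)\<bar> \<le> c * norm (y - \<tau>)"
    proof -
      have "\<exists>d>0. \<forall>y. norm (y - \<tau>) < d \<longrightarrow> norm (p y - p \<tau> - D \<bullet> (y - \<tau>)) \<le> c * norm (y - \<tau>)"
        using der c unfolding has_derivative_at_alt by blast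
      thus ?thesis using that by auto
    qed
    \<comment> \<open>Once \<open>r n\<close> exceeds \<open>K / d\<close>, a rescaled error below
      \<open>K\<close> forces the estimator into the ball of radius \<open>d\<close> where the
      linearization is accurate.\<close>
    have ev1: "\<forall>\<^sub>F n in sequentially. r n > max 0 (K / d)"
      using r unfolding filterlim_at_top_dense by blast
    have ev2: "\<forall>\<^sub>F n in sequentially. (\<integral>\<omega>. norm_ramp K (?Y n \<omega>) \<partial>M) < e / 8"
    proof (rule order_tendstoD(2)[OF Eg])
      show "continuous_on UNIV (norm_ramp K :: real ^ 'k \<Rightarrow> real)"
        by (rule continuous_on_norm_ramp[OF K])
      show "bounded (range (norm_ramp K :: real ^ 'k \<Rightarrow> real))"
        using abs_norm_ramp_le by (intro boundedI[where B = 1]) force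
      show "(\<integral>y. norm_ramp K y \<partial>\<nu>) < e / 8"
        using k unfolding K_def .
    qed
    have "\<forall>\<^sub>F n in sequentially.
      norm ((\<integral>\<omega>. iexp (t * ?W n \<omega>) \<partial>M) - (\<integral>\<omega>. iexp (t * (D \<bullet> ?Y n \<omega>)) \<partial>M) - 0) < e"
      using ev1 ev2
    proof eventually_elim
      case (elim n)
      have rn: "r n > 0" "K < d * r n"
        using elim(1) d(1) by (simp_all add: pos_divide_less_eq mult.commute[of d])
      have pw: "norm (iexp (t * ?W n \<omega>) - iexp (t * (D \<bullet> ?Y n \<omega>))) \<le> e / 4 + 2 * norm_ramp K (?Y n \<omega>)" for \<omega>
      proof (cases "norm (?Y n \<omega>) < K")
        case True
        have "norm (?Y n \<omega>) = norm (T n \<omega> - \<tau>) * r n"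
          using rn(1) by simp
        hence "norm (T n \<omega> - \<tau>) * r n < d * r n"
          using True rn(2) by linarith
        hence "norm (T n \<omega> - \<tau>) < d"
          using rn(1) by (rule mult_right_less_imp_less[OF _ less_imp_le])
        from d(2)[OF this] have "r n * \<bar>p (T n \<omega>) - p \<tau> - D \<bullet> (T n \<omega> - \<tau>)\<bar> \<le> r n * (c * norm (T n \<omega> - \<tau>))"
          using rn(1) by (intro mult_left_mono) auto
        also have "\<dots> = c * norm (?Y n \<omega>)"
          using rn(1) by simp
        also have "\<dots> \<le> c * K"
          using True c by (intro mult_left_mono) auto
        finally have R: "r n * \<bar>p (T n \<omega>) - p \<tau> - D \<bullet> (T n \<omega> - \<tau>)\<bar> \<le> c * K" .
        have "norm (iexp (t * ?W n \<omega>) - iexp (t * (D \<bullet> ?Y n \<omega>))) \<le> \<bar>t * ?W n \<omega> - t * (D \<bullet> ?Y n \<omega>)\<bar>"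
          by (rule norm_iexp_diff_le)
        also have "t * ?W n \<omega> - t * (D \<bullet> ?Y n \<omega>) = t * (r n * (p (T n \<omega>) - p \<tau> - D \<bullet> (T n \<omega> - \<tau>)))"
          by (simp add: algebra_simps)
        also have "\<bar>\<dots>\<bar> = \<bar>t\<bar> * (r n * \<bar>p (T n \<omega>) - p \<tau> - D \<bullet> (T n \<omega> - \<tau>)\<bar>)"
          using rn(1) by (simp add: abs_mult)
        also have "\<dots> \<le> \<bar>t\<bar> * (c * K)"
          using R by (intro mult_left_mono) auto
        finally show ?thesis
          using tcK norm_ramp_bounds(1)[of K "?Y n \<omega>"] by linarith
      next
        case False
        have "norm (iexp (t * ?W n \<omega>) - iexp (t * (D \<bullet> ?Y n \<omega>))) \<le> 1 + 1"
          by (rule norm_triangle_le_diff) simp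
        moreover have "norm_ramp K (?Y n \<omega>) = 1"
          using False K by (intro norm_ramp_eq_1) auto
        ultimately show ?thesis using e by simp
      qed
      have ri: "integrable M (\<lambda>\<omega>. norm_ramp K (?Y n \<omega>))"
        by (rule M.integrable_const_bound[where B = 1]) (auto simp: abs_norm_ramp_le)
      have "(\<integral>\<omega>. iexp (t * ?W n \<omega>) \<partial>M) - (\<integral>\<omega>. iexp (t * (D \<bullet> ?Y n \<omega>)) \<partial>M)
          = (\<integral>\<omega>. iexp (t * ?W n \<omega>) - iexp (t * (D \<bullet> ?Y n \<omega>)) \<partial>M)"
        by (intro Bochner_Integration.integral_diff[symmetric] cint) measurable
      also have "norm \<dots> \<le> (\<integral>\<omega>. e / 4 + 2 * norm_ramp K (?Y n \<omega>) \<partial>M)"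
      proof (rule order_trans[OF integral_norm_bound integral_mono])
        show "integrable M (\<lambda>\<omega>. norm (iexp (t * ?W n \<omega>) - iexp (t * (D \<bullet> ?Y n \<omega>))))"
          by (intro integrable_norm Bochner_Integration.integrable_diff cint) measurable
        show "integrable M (\<lambda>\<omega>. e / 4 + 2 * norm_ramp K (?Y n \<omega>))"
          using ri by simp
      qed (rule pw)
      also have "\<dots> = e / 4 + 2 * (\<integral>\<omega>. norm_ramp K (?Y n \<omega>) \<partial>M)"
        using ri by (simp add: M.prob_space)
      also have "\<dots> < e"
        using elim(2) e by simp
      finally show ?case by simp
    qed
    thus "\<exists>no. \<forall>n\<ge>no. norm ((\<integral>\<omega>. iexp (t * ?W n \<omega>) \<partial>M) - (\<integral>\<omega>. iexp (t * (D \<bullet> ?Y n \<omega>)) \<partial>M) - 0) < e"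
      by (simp add: eventually_sequentially)
  qed
  have "(\<lambda>n. \<integral>\<omega>. iexp (t * ?W n \<omega>) \<partial>M) \<longlonglongrightarrow> (\<integral>y. iexp (t * (D \<bullet> y)) \<partial>\<nu>)"
    using tendsto_add[OF diff lin] by simp
  thus "(\<lambda>n. char (distr M borel (?W n)) t) \<longlonglongrightarrow> char (distr \<nu> borel (\<lambda>x. D \<bullet> x)) t"
    by (simp add: char_def integral_distr)
qed

section \<open>Normal laws, quantiles and coverage\<close>

lemma distr_std_normal_scale:
  assumes "c \<noteq> 0"
  shows "distr std_normal_distribution borel (\<lambda>x. c * x) = density lborel (normal_density 0 \<bar>c\<bar>)"
proof -
  interpret prob_space std_normal_distribution
    by (rule prob_space_normal_density) simp
  have "distributed std_normal_distribution lborel (\<lambda>x. x) (normal_density 0 1)"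
    by (simp add: distributed_def distr_id2 measurable_lborel1)
  from normal_density_affine[OF this _ assms, of 0]
  have "distr std_normal_distribution lborel (\<lambda>x. c * x) = density lborel (normal_density 0 \<bar>c\<bar>)"
    by (simp add: distributed_def)
  moreover have "distr std_normal_distribution lborel (\<lambda>x. c * x) = distr std_normal_distribution borel (\<lambda>x. c * x)"
    by (rule distr_cong) auto
  ultimately show ?thesis by simp
qed

interpretation std_normal: real_distribution std_normal_distribution
  by (simp add: real_distribution_def real_distribution_axioms_def prob_space_normal_density)

lemma measure_normal_singleton: "measure (density lborel (normal_density \<mu> s)) {x} = 0"
proof -
  have "emeasure (density lborel (normal_density \<mu> s)) {x} = 0"
    by (subst emeasure_density) (auto intro!: nn_integral_null_set simp: null_sets_def)
  thus ?thesis by (simp add: measure_def)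
qed

text \<open>Scaling by -1 preserves the law, and the absence of an atom at \<open>x\<close> makes
  open and closed half lines equally likely.\<close>

lemma cdf_std_normal_uminus: "cdf std_normal_distribution (- x) = 1 - cdf std_normal_distribution x"
proof -
  have "std_normal_distribution = distr std_normal_distribution borel (\<lambda>x. - 1 * x)"
    by (subst distr_std_normal_scale) auto
  hence "cdf std_normal_distribution (- x) = measure (distr std_normal_distribution borel (\<lambda>x. - 1 * x)) {..- x}"
    by (simp add: cdf_def)
  also have "\<dots> = std_normal.prob {x..}"
    by (subst measure_distr) (auto intro!: arg_cong[where f = std_normal.prob])
  also have "\<dots> = std_normal.prob (space std_normal_distribution - {..<x})"
    by (rule arg_cong[where f = std_normal.prob]) auto
  also have "\<dots> = 1 - std_normal.prob {..<x}"
    by (rule std_normal.prob_compl) simp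
  also have "std_normal.prob {..x} = std_normal.prob ({..<x} \<union> {x})"
    by (rule arg_cong[where f = std_normal.prob]) auto
  hence "std_normal.prob {..<x} = cdf std_normal_distribution x"
    by (subst (asm) std_normal.finite_measure_Union) (auto simp: measure_normal_singleton cdf_def)
  finally show ?thesis .
qed

text \<open>Continuity makes the set under the infimum closed, so the infimum belongs to it and the
  value there is at least \<open>q\<close>. The intermediate value theorem gives a point with value
  exactly \<open>q\<close>, which lies above the infimum; this is the other inequality.\<close>

lemma cdf_std_normal_quantile:
  assumes "0 < q" "q < 1"
  shows "cdf std_normal_distribution (std_normal_quantile q) = q"
proof -
  let ?\<Phi> = "cdf std_normal_distribution"
  have cont: "isCont ?\<Phi> x" for x
    by (simp add: std_normal.isCont_cdf measure_normal_singleton)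
  obtain a where a: "?\<Phi> a < q"
    using order_tendstoD(2)[OF std_normal.cdf_lim_at_bot assms(1)]
    by (auto simp: eventually_at_bot_linorder)
  obtain b where b: "q < ?\<Phi> b"
    using order_tendstoD(1)[OF std_normal.cdf_lim_at_top_prob assms(2)]
    by (auto simp: eventually_at_top_linorder)
  have "a \<le> b"
    using a b std_normal.cdf_nondecreasing[of b a] by linarith
  then obtain c where c: "?\<Phi> c = q"
    using IVT[of ?\<Phi> a q b] a b cont by auto
  let ?S = "{u. q \<le> ?\<Phi> u}"
  have bdd: "bdd_below ?S"
    using a std_normal.cdf_nondecreasing by (intro bdd_belowI[of _ a]) (metis mem_Collect_eq linorder_le_cases order.strict_trans2 not_less)
  have "closed ?S"
    using cont by (intro closed_Collect_le continuous_at_imp_continuous_on ballI) auto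
  hence "Inf ?S \<in> ?S"
    using c bdd by (intro closed_contains_Inf) auto
  moreover have "?\<Phi> (Inf ?S) \<le> ?\<Phi> c"
    using c bdd by (intro std_normal.cdf_nondecreasing cInf_lower) auto
  ultimately show ?thesis
    using c by (simp add: std_normal_quantile_def)
qed

lemma measure_normal_law_quantile:
  assumes "0 < \<sigma>" "0 < a" "a < 1"
  defines "u \<equiv> std_normal_quantile (1 - a / 2)"
  shows "measure (normal_law 0 (\<sigma>\<^sup>2)) {- \<sigma> * u<..<\<sigma> * u} = 1 - a"
proof -
  let ?\<Phi> = "cdf std_normal_distribution"
  have \<Phi>u: "?\<Phi> u = 1 - a / 2"
    unfolding u_def using assms by (intro cdf_std_normal_quantile) auto
  \<comment> \<open>By symmetry the median is 0, while the level \<open>1 - a / 2\<close> exceeds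
    1/2; so \<open>u\<close> is positive.\<close>
  have "?\<Phi> 0 = 1 / 2"
    using cdf_std_normal_uminus[of 0] by simp
  hence u: "0 < u"
    using \<Phi>u std_normal.cdf_nondecreasing[of u 0] assms by (cases "u \<le> 0") auto
  have "normal_law 0 (\<sigma>\<^sup>2) = distr std_normal_distribution borel (\<lambda>x. \<sigma> * x)"
    using distr_std_normal_scale[of \<sigma>] assms by (simp add: normal_law_def)
  hence "measure (normal_law 0 (\<sigma>\<^sup>2)) {- \<sigma> * u<..<\<sigma> * u}
      = std_normal.prob ((\<lambda>x. \<sigma> * x) -` {- \<sigma> * u<..<\<sigma> * u} \<inter> space std_normal_distribution)"
    by (simp add: measure_distr)
  also have "(\<lambda>x. \<sigma> * x) -` {- \<sigma> * u<..<\<sigma> * u} \<inter> space std_normal_distribution = {- u<..<u}"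
  proof -
    have "- \<sigma> * u < \<sigma> * x \<longleftrightarrow> - u < x" "\<sigma> * x < \<sigma> * u \<longleftrightarrow> x < u" for x
      using mult_less_cancel_left_pos[OF assms(1), of "- u" x] mult_less_cancel_left_pos[OF assms(1), of x u]
      by (simp_all only: mult_minus_left mult_minus_right)
    thus ?thesis by auto
  qed
  also have "std_normal.prob {- u<..<u} = std_normal.prob {- u<..u}"
  proof -
    have "std_normal.prob ({- u<..<u} \<union> {u}) = std_normal.prob {- u<..<u} + std_normal.prob {u}"
      by (rule std_normal.finite_measure_Union) auto
    moreover have "{- u<..<u} \<union> {u} = {- u<..u}" using u by auto
    ultimately show ?thesis by (simp add: measure_normal_singleton)
  qed
  also have "\<dots> = ?\<Phi> u - ?\<Phi> (- u)"
    using u by (simp add: std_normal.cdf_diff_eq)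
  also have "\<dots> = 1 - a"
    using \<Phi>u by (simp add: cdf_std_normal_uminus)
  finally show ?thesis .
qed

lemma confidence_interval_coverage:
  fixes P :: "nat \<Rightarrow> 'a \<Rightarrow> real" and r :: "nat \<Rightarrow> real"
  assumes M: "prob_space M" and [measurable]: "\<And>n. P n \<in> borel_measurable M"
    and conv: "weak_conv_m (\<lambda>n. distr M borel (\<lambda>\<omega>. r n * (P n \<omega> - p))) (normal_law 0 (\<sigma>\<^sup>2))"
    and r: "filterlim r at_top sequentially"
    and \<sigma>: "0 < \<sigma>" and a: "0 < a" "a < 1"
  defines "u \<equiv> std_normal_quantile (1 - a / 2)"
  shows "(\<lambda>n. measure M {\<omega> \<in> space M. p \<in> {P n \<omega> - \<sigma> / r n * u<..<P n \<omega> + \<sigma> / r n * u}})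
    \<longlonglongrightarrow> 1 - a"
proof -
  interpret M: prob_space M by fact
  let ?W = "\<lambda>n \<omega>. r n * (P n \<omega> - p)"
  let ?A = "{- \<sigma> * u<..<\<sigma> * u}"
  have N: "normal_law 0 (\<sigma>\<^sup>2) = density lborel (normal_density 0 \<sigma>)"
    using \<sigma> by (simp add: normal_law_def)
  interpret N: real_distribution "normal_law 0 (\<sigma>\<^sup>2)"
    by (rule real_distribution_normal_law) simp
  have "frontier ?A \<subseteq> {- \<sigma> * u, \<sigma> * u}"
    by (cases "- \<sigma> * u < \<sigma> * u") (auto simp: frontier_def)
  moreover have "N.prob {- \<sigma> * u, \<sigma> * u} = 0"
  proof -
    have "N.prob ({- \<sigma> * u} \<union> {\<sigma> * u}) \<le> N.prob {- \<sigma> * u} + N.prob {\<sigma> * u}"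
      by (rule measure_subadditive) auto
    thus ?thesis
      by (simp add: N measure_normal_singleton measure_le_0_iff insert_commute)
  qed
  ultimately have fr: "N.prob (frontier ?A) = 0"
    using N.finite_measure_mono[of "frontier ?A" "{- \<sigma> * u, \<sigma> * u}"] by (simp add: measure_le_0_iff)
  have "(\<lambda>n. measure (distr M borel (?W n)) ?A) \<longlonglongrightarrow> N.prob ?A"
    using fr by (intro weak_conv_imp_continuity_set_conv[OF _ _ conv])
      (auto intro!: M.real_distribution_distr N.real_distribution_axioms simp: N.emeasure_eq_measure)
  also have "N.prob ?A = 1 - a"
    unfolding u_def using measure_normal_law_quantile[OF \<sigma> a] .
  finally have lim: "(\<lambda>n. measure (distr M borel (?W n)) ?A) \<longlonglongrightarrow> 1 - a" .
  \<comment> \<open>The two events coincide once \<open>r n\<close> is positive, since the interval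
    is solved for the rescaled error by multiplying with \<open>r n\<close>.\<close>
  have "\<forall>\<^sub>F n in sequentially. measure (distr M borel (?W n)) ?A =
      measure M {\<omega> \<in> space M. p \<in> {P n \<omega> - \<sigma> / r n * u<..<P n \<omega> + \<sigma> / r n * u}}"
    using r[unfolded filterlim_at_top_dense, rule_format, of 0]
  proof eventually_elim
    case (elim n)
    have "measure (distr M borel (?W n)) ?A = M.prob (?W n -` ?A \<inter> space M)"
      by (rule measure_distr) auto
    also have "?W n -` ?A \<inter> space M = {\<omega> \<in> space M. p \<in> {P n \<omega> - \<sigma> / r n * u<..<P n \<omega> + \<sigma> / r n * u}}"
      using elim by (auto simp: field_simps)
    finally show ?case .
  qed
  with lim show ?thesis
    by (rule Lim_transform_eventually)
qed

subsection \<open>Differentiability of the h-step probabilities\<close>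

definition state_of :: "nat \<Rightarrow> nat \<Rightarrow> state" where
  "state_of u v = (\<chi> i. if i = 1 then u else v)"

lemma inj_add_state_of: "inj (\<lambda>(u, v). z + state_of u v)"
  by (auto simp: inj_def state_of_def vec_eq_iff forall_2)

type_synonym draws = "state \<times> real \<times> real"

definition draws_measure :: "draws measure" where
  "draws_measure = count_space UNIV \<Otimes>\<^sub>M (lborel \<Otimes>\<^sub>M lborel)"

text \<open>The draws consist of an innovation and the two coefficients. The counting variables are
  left to the kernel, because given the coefficients their geometric laws do not involve
  \<tau>.\<close>

definition step_kernel :: "state \<times> draws \<Rightarrow> state pmf" where
  "step_kernel = (\<lambda>(w, z, a, b). map_pmf (\<lambda>(u, v). z + state_of u v)
     (pair_pmf (diamond_pmf a (w $ 1)) (diamond_pmf b (w $ 2))))"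

text \<open>The guard is essential: \<open>y - z\<close> is truncated, so without it states that
  cannot be reached from \<open>z\<close> would receive mass.\<close>

lemma pmf_step_kernel:
  "pmf (step_kernel (w, z, a, b)) y = (if \<forall>i. z $ i \<le> y $ i
     then pmf (diamond_pmf a (w $ 1)) (y $ 1 - z $ 1) * pmf (diamond_pmf b (w $ 2)) (y $ 2 - z $ 2) else 0)"
proof (cases "\<forall>i. z $ i \<le> y $ i")
  case True
  hence y: "y = (\<lambda>(u, v). z + state_of u v) (y $ 1 - z $ 1, y $ 2 - z $ 2)"
    by (auto simp: state_of_def vec_eq_iff forall_2)
  have "pmf (step_kernel (w, z, a, b)) y = pmf (pair_pmf (diamond_pmf a (w $ 1)) (diamond_pmf b (w $ 2))) (y $ 1 - z $ 1, y $ 2 - z $ 2)"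
    unfolding step_kernel_def prod.case by (subst y) (rule pmf_map_inj'[OF inj_add_state_of])
  thus ?thesis using True by (simp add: pmf_pair)
next
  case False
  hence "y \<notin> (\<lambda>(u, v). z + state_of u v) ` set_pmf (pair_pmf (diamond_pmf a (w $ 1)) (diamond_pmf b (w $ 2)))"
    by (auto simp: vec_eq_iff)
  from pmf_map_outside[OF this] show ?thesis
    using False by (simp only: step_kernel_def prod.case if_False)
qed

definition draws_density ::
    "real \<Rightarrow> (real ^ 'd \<Rightarrow> state pmf) \<Rightarrow> real ^ (2 + 'd::finite) \<Rightarrow> draws \<Rightarrow> real" where
  "draws_density l F \<tau> p = pmf (F (innov \<tau>)) (fst p) *
     (beta_prime_density l (coef \<tau> 1) (fst (snd p)) * beta_prime_density l (coef \<tau> 2) (snd (snd p)))"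

lemma pair_sigma_finite_draws:
  "pair_sigma_finite (count_space (UNIV :: state set)) (lborel \<Otimes>\<^sub>M lborel :: (real \<times> real) measure)"
  "pair_sigma_finite (count_space (UNIV :: state set)) draws_measure"
  unfolding draws_measure_def
  by (intro pair_sigma_finite.intro sigma_finite_pair_measure sigma_finite_measure_count_space
      lborel.sigma_finite_measure_axioms)+

text \<open>These lemmas concern parameters around the true one and hence no particular process,
  whereas the measurability of the mass functions in \<open>a\<close> is derived from a process. It
  is therefore a hypothesis here.\<close>

context
  assumes meas: "\<And>x k. (\<lambda>a. pmf (diamond_pmf a x) k) \<in> borel_measurable borel"
begin

text \<open>The present state and the innovation range over a countable set; once they are fixed,
  the mass function is a product of a function of \<open>a\<close> and a function of
  \<open>b\<close>, or 0.\<close>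

lemma measurable_step_kernel:
  "(\<lambda>s. pmf (step_kernel s) y) \<in> borel_measurable (count_space UNIV \<Otimes>\<^sub>M draws_measure)"
proof -
  note [measurable] = meas
  let ?g = "\<lambda>(w, z) (s :: state \<times> draws). if \<forall>i. z $ i \<le> y $ i
     then pmf (diamond_pmf (fst (snd (snd s))) (w $ 1)) (y $ 1 - z $ 1) *
          pmf (diamond_pmf (snd (snd (snd s))) (w $ 2)) (y $ 2 - z $ 2) else 0"
  have "(\<lambda>s. ?g (fst s, fst (snd s)) s) \<in> borel_measurable (count_space UNIV \<Otimes>\<^sub>M draws_measure)"
  proof (rule measurable_compose_countable[where f = ?g and g = "\<lambda>s. (fst s, fst (snd s))"])
    fix i :: "state \<times> state"
    show "?g i \<in> borel_measurable (count_space UNIV \<Otimes>\<^sub>M draws_measure)"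
      unfolding draws_measure_def by (cases i) (simp only: prod.case, measurable)
  next
    have "(\<lambda>s. (fst s, fst (snd s))) \<in> measurable (count_space UNIV \<Otimes>\<^sub>M draws_measure)
        (count_space (UNIV :: state set) \<Otimes>\<^sub>M count_space (UNIV :: state set))"
      unfolding draws_measure_def by measurable
    thus "(\<lambda>s. (fst s, fst (snd s))) \<in> measurable (count_space (UNIV :: state set) \<Otimes>\<^sub>M draws_measure)
        (count_space (UNIV :: (state \<times> state) set))"
      by (simp add: pair_measure_countable)
  qed
  moreover have "(\<lambda>s. pmf (step_kernel s) y) = (\<lambda>s. ?g (fst s, fst (snd s)) s)"
    by (auto simp: fun_eq_iff pmf_step_kernel)
  ultimately show ?thesis by (simp only:)
qed

lemma measurable_step_kernel_Pair: "(\<lambda>p. pmf (step_kernel (w, p)) y) \<in> borel_measurable draws_measure"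
  using measurable_compose[OF measurable_Pair1' measurable_step_kernel, of w y] by simp

lemma diamond_prob_eq_integral:
  assumes "0 < c" "0 < l"
  shows "diamond_prob c l x k = (\<integral>a. pmf (diamond_pmf a x) k * beta_prime_density l c a \<partial>lborel)"
  unfolding diamond_prob_def beta_prime_eq using meas assms
  by (subst integral_density) (auto simp: beta_prime_density_nonneg mult.commute)

lemma integrable_pmf_diamond_density:
  assumes "0 < c" "0 < l"
  shows "integrable lborel (\<lambda>a. pmf (diamond_pmf a x) k * beta_prime_density l c a)"
proof (rule Bochner_Integration.integrable_bound[OF integrable_beta_prime_density[OF assms]])
  note [measurable] = meas
  show "(\<lambda>a. pmf (diamond_pmf a x) k * beta_prime_density l c a) \<in> borel_measurable lborel"
    by measurable
qed (auto simp: abs_mult pmf_le_1 intro!: mult_left_le_one_le)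

lemma integrable_draws_density:
  assumes "\<And>i. 0 < coef \<tau> i" "0 < l"
  shows "integrable draws_measure (draws_density l F \<tau>)"
proof -
  interpret P: pair_sigma_finite "count_space (UNIV :: state set)" "lborel \<Otimes>\<^sub>M lborel :: (real \<times> real) measure"
    by (rule pair_sigma_finite_draws)
  show ?thesis
    unfolding draws_measure_def draws_density_def
    by (intro P.integrable_mult_product lborel_pair.integrable_mult_product integrable_pmf integrable_beta_prime_density assms)
qed

text \<open>Fubini separates the innovation from the coefficients, and the two coefficients from
  each other. In this form the parameter sits only in \<open>draws_density\<close>.\<close>

lemma trans_prob_eq_integral:
  assumes c: "\<And>i. 0 < coef \<tau> i" and l: "0 < l"
  shows "trans_prob l F \<tau> w y = (\<integral>p. pmf (step_kernel (w, p)) y * draws_density l F \<tau> p \<partial>draws_measure)"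
proof -
  interpret P: pair_sigma_finite "count_space (UNIV :: state set)" "lborel \<Otimes>\<^sub>M lborel :: (real \<times> real) measure"
    by (rule pair_sigma_finite_draws)
  let ?I = "{z. \<forall>i. z $ i \<le> y $ i}"
  let ?f = "\<lambda>i a z. pmf (diamond_pmf a (w $ i)) (y $ i - z $ i) * beta_prime_density l (coef \<tau> i) a"
  let ?h = "\<lambda>z. if z \<in> ?I then pmf (F (innov \<tau>)) z * (\<Prod>i\<in>UNIV. diamond_prob (coef \<tau> i) l (w $ i) (y $ i - z $ i)) else 0"
  have int: "integrable draws_measure (\<lambda>p. pmf (step_kernel (w, p)) y * draws_density l F \<tau> p)"
    using integrable_pmf_scaleR[OF integrable_draws_density[OF assms] measurable_step_kernel_Pair] by simp
  have "(\<integral>p. pmf (step_kernel (w, p)) y * draws_density l F \<tau> p \<partial>draws_measure)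
      = (\<integral>z. (\<integral>q. pmf (step_kernel (w, z, q)) y * draws_density l F \<tau> (z, q) \<partial>(lborel \<Otimes>\<^sub>M lborel)) \<partial>count_space UNIV)"
    using P.integral_fst'[OF int[unfolded draws_measure_def]] by (simp add: draws_measure_def)
  also have "\<dots> = (\<integral>z. ?h z \<partial>count_space UNIV)"
  proof (rule Bochner_Integration.integral_cong[OF refl])
    fix z :: state
    show "(\<integral>q. pmf (step_kernel (w, z, q)) y * draws_density l F \<tau> (z, q) \<partial>(lborel \<Otimes>\<^sub>M lborel)) = ?h z"
    proof (cases "z \<in> ?I")
      case True
      have "(\<integral>q. pmf (step_kernel (w, z, q)) y * draws_density l F \<tau> (z, q) \<partial>(lborel \<Otimes>\<^sub>M lborel))
          = (\<integral>q. pmf (F (innov \<tau>)) z * (?f 1 (fst q) z * ?f 2 (snd q) z) \<partial>(lborel \<Otimes>\<^sub>M lborel))"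
        using True by (intro Bochner_Integration.integral_cong refl)
          (auto simp: pmf_step_kernel draws_density_def mult_ac split: prod.splits)
      also have "\<dots> = pmf (F (innov \<tau>)) z * ((\<integral>a. ?f 1 a z \<partial>lborel) * (\<integral>b. ?f 2 b z \<partial>lborel))"
        using lborel_pair.integral_mult_product[OF integrable_pmf_diamond_density[OF c l] integrable_pmf_diamond_density[OF c l]]
        by simp
      also have "\<dots> = ?h z"
        using True by (simp add: diamond_prob_eq_integral[OF c l] UNIV_2)
      finally show ?thesis .
    next
      case False
      hence "pmf (step_kernel (w, z, q)) y = 0" for q
        by (cases q) (auto simp: pmf_step_kernel)
      thus ?thesis
        using False by (simp only: if_False mult_zero_left Bochner_Integration.integral_zero)
    qed
  qed
  \<comment> \<open>The integral over all innovations is turned into an unordered sum in order to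
    discard the \<open>z\<close> not below \<open>y\<close>, which leaves a finite sum.\<close>
  also have "\<dots> = infsum ?h UNIV"
    by (rule infsum_eq_integral_count_space[symmetric])
  also have "\<dots> = infsum ?h ?I"
    by (rule infsum_cong_neutral) auto
  also have "\<dots> = trans_prob l F \<tau> w y"
  proof -
    have "finite ?I"
      by (rule finite_states_le)
    thus ?thesis by (simp add: trans_prob_def)
  qed
  finally show ?thesis by simp
qed

text \<open>One step applies \<open>step_kernel\<close> to the product of the current row and the
  density of fresh draws. Integrability of the row comes from the induction hypothesis, since
  \<open>L1_deriv\<close> includes it near \<tau>.\<close>

lemma hstep_prob_Suc_eq_integral:
  assumes c: "\<And>i. 0 < coef \<tau> i" and l: "0 < l"
    and h: "integrable (count_space UNIV) (hstep_prob l F h \<tau> x)"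
  shows "hstep_prob l F (Suc h) \<tau> x y =
    (\<integral>s. pmf (step_kernel s) y * (hstep_prob l F h \<tau> x (fst s) * draws_density l F \<tau> (snd s))
      \<partial>(count_space UNIV \<Otimes>\<^sub>M draws_measure))"
proof -
  interpret P: pair_sigma_finite "count_space (UNIV :: state set)" draws_measure
    by (rule pair_sigma_finite_draws)
  have i: "integrable (count_space UNIV \<Otimes>\<^sub>M draws_measure)
      (\<lambda>s. hstep_prob l F h \<tau> x (fst s) * draws_density l F \<tau> (snd s))"
    by (intro P.integrable_mult_product h integrable_draws_density c l)
  have "integrable (count_space UNIV \<Otimes>\<^sub>M draws_measure)
      (\<lambda>s. pmf (step_kernel s) y * (hstep_prob l F h \<tau> x (fst s) * draws_density l F \<tau> (snd s)))"
    using integrable_pmf_scaleR[OF i measurable_step_kernel] by simp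
  from P.integral_fst'[OF this]
  have "(\<integral>s. pmf (step_kernel s) y * (hstep_prob l F h \<tau> x (fst s) * draws_density l F \<tau> (snd s))
      \<partial>(count_space UNIV \<Otimes>\<^sub>M draws_measure)) =
    (\<integral>w. (\<integral>p. hstep_prob l F h \<tau> x w * (pmf (step_kernel (w, p)) y * draws_density l F \<tau> p) \<partial>draws_measure) \<partial>count_space UNIV)"
    by (simp add: mult.left_commute)
  also have "\<dots> = hstep_prob l F (Suc h) \<tau> x y"
    by (simp add: trans_prob_eq_integral[OF c l] infsum_eq_integral_count_space)
  finally show ?thesis by simp
qed

end

section \<open>Differentiating the density of the draws and the rows\<close>

definition param_of_innov :: "real ^ 'd::finite \<Rightarrow> real ^ (2 + 'd)" where
  "param_of_innov u = (\<chi> k. case k of Inl _ \<Rightarrow> 0 | Inr j \<Rightarrow> u $ j)"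

text \<open>\<open>param_of_innov\<close> is the adjoint of \<open>innov\<close>, so by the chain
  rule it carries a gradient in the innovation parameters to one in the full parameter.\<close>

lemma inner_param_of_innov: "param_of_innov u \<bullet> v = u \<bullet> innov v"
proof -
  have "param_of_innov u \<bullet> v = (\<Sum>k\<in>UNIV <+> UNIV. (case k of Inl _ \<Rightarrow> 0 | Inr j \<Rightarrow> u $ j) * v $ k)"
    by (simp add: inner_vec_def param_of_innov_def)
  also have "\<dots> = u \<bullet> innov v"
    by (subst sum.Plus) (simp_all add: inner_vec_def innov_def)
  finally show ?thesis .
qed

lemma norm_param_of_innov: "norm (param_of_innov u) = norm u"
proof -
  have "innov (param_of_innov u) = u"
    by (simp add: innov_def param_of_innov_def vec_eq_iff)
  thus ?thesis
    by (simp add: norm_eq_sqrt_inner inner_param_of_innov)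
qed

lemma bounded_linear_innov: "bounded_linear innov"
  by (rule linear_conv_bounded_linear[THEN iffD1]) (auto intro!: linearI simp: innov_def vec_eq_iff)

lemma L1_deriv_innovations:
  assumes "smooth_family F (innov \<tau>)"
  shows "\<exists>g. L1_deriv (count_space UNIV) (\<lambda>\<tau>'. pmf (F (innov \<tau>'))) g \<tau>"
proof -
  obtain U g and b :: "state \<Rightarrow> real" where U: "open U" "innov \<tau> \<in> U" and b: "b summable_on UNIV"
    and der: "\<And>z \<theta>. \<theta> \<in> U \<Longrightarrow> ((\<lambda>\<theta>. pmf (F \<theta>) z) has_derivative (\<lambda>v. g z \<theta> \<bullet> v)) (at \<theta>)"
    and bound: "\<And>z \<theta>. \<theta> \<in> U \<Longrightarrow> norm (g z \<theta>) \<le> b z"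
    using assms unfolding smooth_family_def by blast
  have "L1_deriv (count_space UNIV) (\<lambda>\<tau>'. pmf (F (innov \<tau>'))) (\<lambda>z. param_of_innov (g z (innov \<tau>))) \<tau>"
  proof (rule L1_deriv_dominated[where U = "innov -` U" and g = "\<lambda>\<tau>' z. param_of_innov (g z (innov \<tau>'))"])
    show "open (innov -` U)"
      using U(1) by (rule open_vimage) (rule linear_continuous_on[OF bounded_linear_innov])
    show "((\<lambda>\<tau>. pmf (F (innov \<tau>)) z) has_derivative (\<lambda>v. param_of_innov (g z (innov \<tau>')) \<bullet> v)) (at \<tau>')"
      if "\<tau>' \<in> innov -` U" for \<tau>' z
      using has_derivative_compose[OF bounded_linear.has_derivative[OF bounded_linear_innov has_derivative_ident] der] that
      by (simp add: inner_param_of_innov)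
    show "integrable (count_space UNIV) b"
      using b trans[OF summable_on_iff_abs_summable_on_real abs_summable_equivalent, of b UNIV]
      unfolding Infinite_Set_Sum.abs_summable_on_def by blast
  qed (use U bound in \<open>auto simp: norm_param_of_innov integrable_pmf\<close>)
  thus ?thesis by blast
qed

lemma L1_deriv_draws_density:
  fixes F :: "real ^ 'd::finite \<Rightarrow> state pmf"
  assumes "smooth_family F (innov \<tau>)" and c: "\<And>i. 0 < coef \<tau> i" and l: "0 < l"
  shows "\<exists>g. L1_deriv draws_measure (draws_density l F) g \<tau>"
proof -
  interpret P: pair_sigma_finite "count_space (UNIV :: state set)" "lborel \<Otimes>\<^sub>M lborel :: (real \<times> real) measure"
    by (rule pair_sigma_finite_draws)
  obtain g g1 g2 where g: "L1_deriv (count_space UNIV) (\<lambda>\<tau>'. pmf (F (innov \<tau>'))) g \<tau>"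
    "L1_deriv lborel (\<lambda>\<tau>'. beta_prime_density l (coef \<tau>' 1)) g1 \<tau>"
    "L1_deriv lborel (\<lambda>\<tau>'. beta_prime_density l (coef \<tau>' 2)) g2 \<tau>"
    using L1_deriv_innovations[OF assms(1)] L1_deriv_beta_prime_density[OF c[unfolded coef_def] l]
    unfolding coef_def by metis
  show ?thesis
    using P.L1_deriv_product[OF g(1) lborel_pair.L1_deriv_product[OF g(2,3)]]
    unfolding draws_density_def draws_measure_def by blast
qed

lemma L1_deriv_hstep_prob:
  fixes F :: "real ^ 'd::finite \<Rightarrow> state pmf"
  assumes meas: "\<And>x k. (\<lambda>a. pmf (diamond_pmf a x) k) \<in> borel_measurable borel"
    and F: "smooth_family F (innov \<tau>)" and c: "\<And>i. 0 < coef \<tau> i" and l: "0 < l"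
  shows "\<exists>g. L1_deriv (count_space UNIV) (\<lambda>\<tau>'. hstep_prob l F h \<tau>' x) g \<tau>"
proof (induction h)
  case 0
  \<comment> \<open>The initial row is the point mass at \<open>x\<close>, whatever the
    parameter.\<close>
  have "pmf (return_pmf x) = (\<lambda>y. if x = y then 1 else 0)"
    by (auto simp: fun_eq_iff)
  hence "integrable (count_space UNIV) (\<lambda>y. if x = y then 1 else 0 :: real)"
    by (metis integrable_pmf)
  from L1_deriv_const[OF this] show ?case by auto
next
  case (Suc h)
  interpret P: pair_sigma_finite "count_space (UNIV :: state set)" draws_measure
    by (rule pair_sigma_finite_draws)
  obtain g k where g: "L1_deriv (count_space UNIV) (\<lambda>\<tau>'. hstep_prob l F h \<tau>' x) g \<tau>"
    and k: "L1_deriv draws_measure (draws_density l F) k \<tau>"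
    using Suc.IH L1_deriv_draws_density[OF F c l] by blast
  have "open {\<tau>' :: real ^ (2 + 'd). 0 < coef \<tau>' i}" for i
    unfolding coef_def by (intro open_Collect_less continuous_intros)
  hence "\<forall>\<^sub>F \<tau>' in nhds \<tau>. 0 < coef \<tau>' i" for i
    using c[of i] by (metis (mono_tags, lifting) eventually_nhds mem_Collect_eq)
  hence "\<forall>\<^sub>F \<tau>' in nhds \<tau>. \<forall>i. 0 < coef \<tau>' i"
    by (simp add: eventually_all_finite)
  \<comment> \<open>The integral formula requires positive coefficients and an integrable row. The
    first is an open condition, the second holds near \<tau> by the induction hypothesis.\<close>
  hence eq: "\<forall>\<^sub>F \<tau>' in nhds \<tau>. \<forall>y. hstep_prob l F (Suc h) \<tau>' x y =
    (\<integral>s. pmf (step_kernel s) y * (hstep_prob l F h \<tau>' x (fst s) * draws_density l F \<tau>' (snd s))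
      \<partial>(count_space UNIV \<Otimes>\<^sub>M draws_measure))"
    using L1_deriv_integrable(1)[OF g]
  proof eventually_elim
    case (elim \<tau>')
    show ?case
      using elim l by (intro allI hstep_prob_Suc_eq_integral meas) auto
  qed
  show ?case
    using L1_deriv_cong[OF L1_deriv_kernel[OF P.L1_deriv_product[OF g k] measurable_step_kernel[OF meas]] eq]
    by blast
qed

section \<open>Gradients, and assembly of the result\<close>

lemma has_derivative_partial:
  fixes p :: "real ^ 'k::finite \<Rightarrow> real"
  assumes "(p has_derivative (\<lambda>v. D \<bullet> v)) (at \<tau>)"
  shows "((\<lambda>s. p (\<tau> + s *\<^sub>R axis k 1)) has_field_derivative D $ k) (at 0)"
proof -
  have "((\<lambda>s. \<tau> + s *\<^sub>R axis k 1) has_derivative (\<lambda>s. s *\<^sub>R axis k 1)) (at 0)"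
    by (auto intro!: derivative_eq_intros)
  moreover have "(p has_derivative (\<lambda>v. D \<bullet> v)) (at (\<tau> + 0 *\<^sub>R axis k 1))"
    using assms by simp
  ultimately have "((\<lambda>s. p (\<tau> + s *\<^sub>R axis k 1)) has_derivative (\<lambda>s. D \<bullet> (s *\<^sub>R axis k 1))) (at 0)"
    by (rule has_derivative_compose)
  thus ?thesis
    by (simp add: has_field_derivative_def inner_axis mult_commute_abs)
qed

text \<open>\<open>grad\<close> is built from \<open>deriv\<close>, which is informative only where
  a derivative exists; the Frechet derivative supplies the existence of each partial derivative
  together with its value.\<close>

lemma grad_eq: "(p has_derivative (\<lambda>v. D \<bullet> v)) (at \<tau>) \<Longrightarrow> grad p \<tau> = D"
  using has_derivative_partial[of p D \<tau>]
  by (auto simp: grad_def partial_deriv_def vec_eq_iff intro!: DERIV_imp_deriv)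

theorem theorem5p1:
  fixes M :: "'a measure"
    and l :: real
    and F :: "real ^ 'd::finite \<Rightarrow> state pmf"
    and \<Theta> :: "(real ^ (2 + 'd)) set"
    and \<tau> :: "real ^ (2 + 'd)"
    and \<alpha> :: "2 \<Rightarrow> nat \<Rightarrow> 'a \<Rightarrow> real"
    and G :: "2 \<Rightarrow> nat \<Rightarrow> nat \<Rightarrow> 'a \<Rightarrow> nat"
    and Z X :: "nat \<Rightarrow> 'a \<Rightarrow> state"
    and \<pi> :: "state pmf"
    and est :: "state list \<Rightarrow> real ^ (2 + 'd)"
    and h :: nat and x\<^sub>1 x y :: state
  defines "p \<equiv> \<lambda>\<tau>'. hstep_prob l F h \<tau>' x y"
    and "I \<equiv> fisher_info l F \<tau> \<pi>"
  defines "D \<equiv> grad p \<tau>"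
  defines "\<sigma> \<equiv> sqrt (D \<bullet> (matrix_inv I *v D))"
  assumes process: "brcmnbinar M l (coef \<tau>) (F (innov \<tau>)) \<alpha> G Z X"
    and initial: "AE \<omega> in M. X 1 \<omega> = x\<^sub>1"
    and regular: "regular_model l F \<Theta> \<tau> \<pi>"
    and cml: "cml_estimator M X l F \<Theta> est"
    and cml_normal: "\<exists>\<nu>. multivariate_normal \<nu> 0 (matrix_inv I) \<and>
      weak_conv_vec
        (\<lambda>n. distr M borel (\<lambda>\<omega>. sqrt (real n - 1) *\<^sub>R (est (observed X n \<omega>) - \<tau>))) \<nu>"
    and h_pos: "1 \<le> h"
  shows
    "(\<forall>n\<ge>1. measure M {\<omega> \<in> space M. X n \<omega> = x} > 0 \<longrightarrow>
        cond_prob M (\<lambda>\<omega>. X (n + h) \<omega> = y) (\<lambda>\<omega>. X n \<omega> = x) = p \<tau>) \<and>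
     (\<forall>k. (\<lambda>s. p (\<tau> + s *\<^sub>R axis k 1)) differentiable (at 0)) \<and>
     0 \<le> D \<bullet> (matrix_inv I *v D) \<and>
     weak_conv_m
       (\<lambda>n. distr M borel (\<lambda>\<omega>. sqrt (real n - 1) * (p (est (observed X n \<omega>)) - p \<tau>)))
       (normal_law 0 (\<sigma>\<^sup>2)) \<and>
     (0 < \<sigma> \<longrightarrow>
       (\<forall>a. 0 < a \<and> a < 1 \<longrightarrow>
         (\<lambda>n. measure M {\<omega> \<in> space M.
              p \<tau> \<in> {p (est (observed X n \<omega>)) - \<sigma> / sqrt (real n - 1) * std_normal_quantile (1 - a / 2)
                     <..< p (est (observed X n \<omega>)) + \<sigma> / sqrt (real n - 1) * std_normal_quantile (1 - a / 2)}})
         \<longlonglongrightarrow> 1 - a))"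
proof -
  interpret brcmnbinar M l "coef \<tau>" "F (innov \<tau>)" \<alpha> G Z X by (rule process)
  have T: "trans_prob l F \<tau> w v = transition w v" for w v
    by (simp add: trans_prob_def transition_def)
  obtain g where "L1_deriv (count_space UNIV) (\<lambda>\<tau>'. hstep_prob l F h \<tau>' x) g \<tau>"
    using L1_deriv_hstep_prob[OF borel_measurable_pmf_diamond, of F \<tau> l h x] regular m_range l_gt
    by (auto simp: regular_model_def)
  from L1_deriv_count_space_has_derivative[OF this, of y]
  have der: "(p has_derivative (\<lambda>v. g y \<bullet> v)) (at \<tau>)"
    by (simp add: p_def)
  have D: "D = g y"
    unfolding D_def by (rule grad_eq[OF der])
  obtain \<nu> where \<nu>: "multivariate_normal \<nu> 0 (matrix_inv I)"
    "weak_conv_vec (\<lambda>n. distr M borel (\<lambda>\<omega>. sqrt (real n - 1) *\<^sub>R (est (observed X n \<omega>) - \<tau>))) \<nu>"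
    using cml_normal by blast
  \<comment> \<open>Multivariate normality is applied to the linear combination with coefficients
    \<open>D\<close>; nonnegativity of the quadratic form lets the square undo the root in
    \<sigma>.\<close>
  have nonneg: "0 \<le> D \<bullet> (matrix_inv I *v D)"
    and law: "distr \<nu> borel (\<lambda>x. D \<bullet> x) = normal_law 0 (\<sigma>\<^sup>2)"
    using \<nu>(1) by (simp_all add: multivariate_normal_def \<sigma>_def)
  \<comment> \<open>For n = 0 the observed list is empty, a constant; the history lemma covers the
    times from 1 on.\<close>
  have obs: "observed X n \<in> measurable M (count_space UNIV)" for n
  proof (cases "n = 0")
    case False
    thus ?thesis
      using measurable_history[of "Suc n"] by (simp add: observed_def[abs_def] del: upt_Suc)
  qed (simp add: observed_def[abs_def])
  \<comment> \<open>Observed paths are discrete random variables, so every function of them is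
    measurable: this covers the estimator as well as its composition with \<open>p\<close>.\<close>
  have est: "(\<lambda>\<omega>. q (est (observed X n \<omega>))) \<in> borel_measurable M" for q :: "_ \<Rightarrow> 'z::topological_space" and n
    by (rule measurable_compose[OF obs]) simp
  have r: "filterlim (\<lambda>n. sqrt (real n - 1)) at_top sequentially"
    by real_asymp
  have conv: "weak_conv_m
       (\<lambda>n. distr M borel (\<lambda>\<omega>. sqrt (real n - 1) * (p (est (observed X n \<omega>)) - p \<tau>)))
       (normal_law 0 (\<sigma>\<^sup>2))"
    using delta_method[OF prob_space_axioms est[of "\<lambda>x. x"] est _ _ \<nu>(2) r der] \<nu>(1)
    by (simp add: law D[symmetric] multivariate_normal_def)
  have markov: "cond_prob M (\<lambda>\<omega>. X (n + h) \<omega> = y) (\<lambda>\<omega>. X n \<omega> = x) = p \<tau>"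
    if "1 \<le> n" "0 < measure M {\<omega> \<in> space M. X n \<omega> = x}" for n
    using that prob_hstep[where F = F and \<tau> = \<tau> and h = h and x = x and y = y, OF T that(1)]
    by (simp add: cond_prob_def p_def conj_commute)
  show ?thesis
  proof (intro conjI allI impI)
    fix k
    show "(\<lambda>s. p (\<tau> + s *\<^sub>R axis k 1)) differentiable at 0"
      using has_derivative_partial[OF der, of k]
      by (auto simp: differentiable_def has_field_derivative_def)
  next
    fix a :: real assume "0 < \<sigma>" "0 < a \<and> a < 1"
    thus "(\<lambda>n. measure M {\<omega> \<in> space M.
              p \<tau> \<in> {p (est (observed X n \<omega>)) - \<sigma> / sqrt (real n - 1) * std_normal_quantile (1 - a / 2)
                     <..< p (est (observed X n \<omega>)) + \<sigma> / sqrt (real n - 1) * std_normal_quantile (1 - a / 2)}})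
         \<longlonglongrightarrow> 1 - a"
      by (intro confidence_interval_coverage[OF prob_space_axioms est conv r]) auto
  qed (use markov nonneg conv in auto)
qed

end
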